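(* Let $i\ge0$ and let $K$ be an $(i+1)$-path connected finite abstract simplicial complex having at least one $(i+1)$-face. The following statements are equivalent: 1. The spectrum of $\Delta_i^{up}(K)$ contains the eigenvalue $i+2$. 2. There are no orientable $(i+1)$-circuits of odd length and no non-orientable $(i+1)$-circuits of even length in $K$.
   Context: For a finite abstract simplicial complex $K$ (closed under inclusion, containing the empty face), $S_i(K)$ is the set of $i$-faces and $C^i(K,\mathbb{R})$ is the space of real functions on oriented $i$-faces that change sign when the orientation is reversed. The coboundary $\delta_i:C^i\to C^{i+1}$ is $(\delta_i f)([v_0,\dots,v_{i+1}])=\sum_{j}(-1)^j f([v_0,\dots,\hat v_j,\dots,v_{i+1}])$. A positive weight function $w$ on faces defines inner products $(f,g)_{C^i}=\sum_{F\in S_i(K)}w(F)f([F])g([F])$, with adjoint $\delta_i^*$. The degree of an $i$-face is $\deg F=\sum_{\bar F\in S_{i+1}(K),\,F\subset\bar F}w(\bar F)$. The normalized combinatorial Laplacian is $\Delta_i^{up}(K)=\delta_i^*\delta_i$ on $C^i(K,\mathbb{R})$ for the weight function with $w(F)=1$ for every facet (inclusion-maximal face) and $w(F)=\deg F$ for every other face. $K$ is $(i+1)$-path connected if any two $(i+1)$-faces can be joined by a sequence of $(i+1)$-faces in which consecutive ones share an $i$-face. An $(i+1)$-circuit of length $m\ge3$ in $K$ is a pure $(i+1)$-dimensional subcomplex whose distinct $(i+1)$-faces can be listed cyclically as $F_1,\dots,F_m$ so that two distinct $F_j,F_l$ intersect in an $i$-face if and only if $j,l$ are cyclically consecutive ($j-l\equiv\pm1\bmod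 m$). A pure $(i+1)$-dimensional complex is orientable if its $(i+1)$-faces can be oriented so that any two that intersect in an $i$-face induce different (opposite) orientations on that face. *)

theory Defs
  imports Complex_Main "HOL-Combinatorics.Permutations"
begin

definition abstract_complex :: "'a set set \<Rightarrow> bool" where
  "abstract_complex K \<longleftrightarrow>
     finite K \<and> {} \<in> K \<and> (\<forall>F\<in>K. finite F \<and> (\<forall>G. G \<subseteq> F \<longrightarrow> G \<in> K))"

definition faces :: "'a set set \<Rightarrow> nat \<Rightarrow> 'a set set" where
  "faces K i = {F \<in> K. card F = i + 1}"

definition is_facet :: "'a set set \<Rightarrow> 'a set \<Rightarrow> bool" where
  "is_facet K F \<longleftrightarrow> F \<in> K \<and> \<not> (\<exists>G\<in>K. F \<subset> G)"

definition orderings :: "'a set \<Rightarrow> 'a list set" where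
  "orderings F = {xs. distinct xs \<and> set xs = F}"

definition some_ordering :: "'a set \<Rightarrow> 'a list" where
  "some_ordering F = (SOME xs. xs \<in> orderings F)"

text \<open>
  A function on the oriented faces that changes sign under reversal of the orientation is encoded
  as a function on duplicate-free vertex lists, the value at \<open>[v0, ..., vi]\<close> being the value
  at the oriented face which that list represents.  Functions are set to 0 at all other lists, so
  that equality of cochains is equality of functions.
\<close>

definition alternating_on :: "'a set \<Rightarrow> ('a list \<Rightarrow> 'b::ring_1) \<Rightarrow> bool" where
  "alternating_on F f \<longleftrightarrow>
     (\<forall>xs\<in>orderings F. \<forall>p. p permutes F \<longrightarrow> f (map p xs) = of_int (sign p) * f xs)"

definition cochains :: "'a set set \<Rightarrow> nat \<Rightarrow> ('a list \<Rightarrow> real) set" where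
  "cochains K i =
     {f. (\<forall>F\<in>faces K i. alternating_on F f) \<and> (\<forall>xs. xs \<notin> \<Union>(orderings ` faces K i) \<longrightarrow> f xs = 0)}"

definition coboundary :: "'a set set \<Rightarrow> nat \<Rightarrow> ('a list \<Rightarrow> real) \<Rightarrow> 'a list \<Rightarrow> real" where
  "coboundary K i f xs =
     (if xs \<in> \<Union>(orderings ` faces K (i + 1))
      then \<Sum>j<length xs. (-1) ^ j * f (take j xs @ drop (Suc j) xs)
      else 0)"

text \<open>
  For two cochains the product \<open>f xs * g xs\<close> is the same for all orderings \<open>xs\<close> of a face, so
  the choice made by \<open>some_ordering\<close> is immaterial.
\<close>

definition cochain_inner ::
  "'a set set \<Rightarrow> ('a set \<Rightarrow> real) \<Rightarrow> nat \<Rightarrow> ('a list \<Rightarrow> real) \<Rightarrow> ('a list \<Rightarrow> real) \<Rightarrow> real" where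
  "cochain_inner K w i f g =
     (\<Sum>F\<in>faces K i. w F * f (some_ordering F) * g (some_ordering F))"

text \<open>For a finite complex and a positive weight the adjoint exists and is unique.\<close>

definition coboundary_adjoint ::
  "'a set set \<Rightarrow> ('a set \<Rightarrow> real) \<Rightarrow> nat \<Rightarrow> ('a list \<Rightarrow> real) \<Rightarrow> 'a list \<Rightarrow> real" where
  "coboundary_adjoint K w i g =
     (THE h. h \<in> cochains K i \<and>
        (\<forall>f\<in>cochains K i. cochain_inner K w (i + 1) (coboundary K i f) g = cochain_inner K w i f h))"

definition up_laplacian ::
  "'a set set \<Rightarrow> ('a set \<Rightarrow> real) \<Rightarrow> nat \<Rightarrow> ('a list \<Rightarrow> real) \<Rightarrow> 'a list \<Rightarrow> real" where
  "up_laplacian K w i f = coboundary_adjoint K w i (coboundary K i f)"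

definition cofaces :: "'a set set \<Rightarrow> 'a set \<Rightarrow> 'a set set" where
  "cofaces K F = {G \<in> K. F \<subset> G \<and> card G = card F + 1}"

definition face_degree :: "'a set set \<Rightarrow> ('a set \<Rightarrow> real) \<Rightarrow> 'a set \<Rightarrow> real" where
  "face_degree K w F = (\<Sum>G\<in>cofaces K F. w G)"

text \<open>
  The recursion ascends through the faces; the value 0 when \<open>K\<close> is infinite or \<open>F\<close> is not a
  face of \<open>K\<close> only serves to make the function total.
\<close>

function normalized_weight :: "'a set set \<Rightarrow> 'a set \<Rightarrow> real" where
  "normalized_weight K F =
     (if infinite K \<or> F \<notin> K then 0
      else if is_facet K F then 1
      else \<Sum>G\<in>cofaces K F. normalized_weight K G)"
  by pat_completeness auto
termination
proof (relation "measure (\<lambda>(K, F). card {G \<in> K. F \<subset> G})", goal_cases)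
  case (2 K F G)
  then have "{H \<in> K. G \<subset> H} \<subset> {H \<in> K. F \<subset> H}" "finite {H \<in> K. F \<subset> H}"
    by (auto simp: cofaces_def)
  then show ?case
    by (simp add: psubset_card_mono)
qed simp

declare normalized_weight.simps [simp del]

lemma normalized_weight_facet:
  "abstract_complex K \<Longrightarrow> is_facet K F \<Longrightarrow> normalized_weight K F = 1"
  by (simp add: normalized_weight.simps abstract_complex_def is_facet_def)

lemma normalized_weight_nonfacet:
  "abstract_complex K \<Longrightarrow> F \<in> K \<Longrightarrow> \<not> is_facet K F \<Longrightarrow>
     normalized_weight K F = face_degree K (normalized_weight K) F"
  by (subst normalized_weight.simps) (simp add: abstract_complex_def face_degree_def)

definition normalized_up_spectrum :: "'a set set \<Rightarrow> nat \<Rightarrow> real set" where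
  "normalized_up_spectrum K i =
     {c. \<exists>f\<in>cochains K i. f \<noteq> (\<lambda>_. 0) \<and>
           up_laplacian K (normalized_weight K) i f = (\<lambda>xs. c * f xs)}"

text \<open>
  In the following, the argument \<open>i\<close> refers to \<open>(i+1)\<close>-path connectedness and to
  \<open>(i+1)\<close>-circuits.
\<close>

definition path_connected_Suc :: "'a set set \<Rightarrow> nat \<Rightarrow> bool" where
  "path_connected_Suc K i \<longleftrightarrow>
     (\<forall>F\<in>faces K (i + 1). \<forall>G\<in>faces K (i + 1).
        (F, G) \<in> {(A, B). A \<in> faces K (i + 1) \<and> B \<in> faces K (i + 1) \<and>
                           (\<exists>E\<in>faces K i. E \<subseteq> A \<and> E \<subseteq> B)}\<^sup>*)"

definition pure_complex :: "'a set set \<Rightarrow> nat \<Rightarrow> bool" where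
  "pure_complex L d \<longleftrightarrow> abstract_complex L \<and> (\<forall>F. is_facet L F \<longrightarrow> F \<in> faces L d)"

definition circuit_Suc :: "'a set set \<Rightarrow> nat \<Rightarrow> nat \<Rightarrow> 'a set set \<Rightarrow> bool" where
  "circuit_Suc K i m L \<longleftrightarrow>
     3 \<le> m \<and> L \<subseteq> K \<and> pure_complex L (i + 1) \<and>
     (\<exists>Fs. distinct Fs \<and> length Fs = m \<and> set Fs = faces L (i + 1) \<and>
        (\<forall>j<m. \<forall>l<m. j \<noteq> l \<longrightarrow>
           (Fs ! j \<inter> Fs ! l \<in> faces L i \<longleftrightarrow> l = (j + 1) mod m \<or> j = (l + 1) mod m)))"

text \<open>
  An orientation of a face is an alternating choice of signs for its orderings: the oriented face
  \<open>[v0, ..., vk]\<close> is the orientation which is 1 at that list.  In this way a vertex also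
  has two orientations.
\<close>

definition face_orientation :: "'a set \<Rightarrow> ('a list \<Rightarrow> int) \<Rightarrow> bool" where
  "face_orientation F a \<longleftrightarrow>
     alternating_on F a \<and> (\<forall>xs\<in>orderings F. a xs \<in> {1, -1}) \<and> (\<forall>xs. xs \<notin> orderings F \<longrightarrow> a xs = 0)"

text \<open>
  The orientation induced on \<open>F - {v}\<close>.  Since \<open>a (vj # ys) = (-1)^j\<close> if \<open>a\<close> is
  1 at \<open>[v0, ..., vk]\<close> and \<open>ys\<close> is this list without \<open>vj\<close>, it is the usual
  orientation \<open>(-1)^j [v0, ..., vk without vj]\<close>.
\<close>

definition induced_orientation :: "'a \<Rightarrow> ('a list \<Rightarrow> int) \<Rightarrow> 'a list \<Rightarrow> int" where
  "induced_orientation v a = (\<lambda>ys. a (v # ys))"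

definition orientable_Suc :: "'a set set \<Rightarrow> nat \<Rightarrow> bool" where
  "orientable_Suc L i \<longleftrightarrow>
     (\<exists>a. (\<forall>F\<in>faces L (i + 1). face_orientation F (a F)) \<and>
        (\<forall>F\<in>faces L (i + 1). \<forall>G\<in>faces L (i + 1). \<forall>u v.
           F \<noteq> G \<and> F \<inter> G \<in> faces L i \<and> F - G = {u} \<and> G - F = {v} \<longrightarrow>
             induced_orientation u (a F) = (\<lambda>ys. - induced_orientation v (a G) ys)))"

end

theory Submission
  imports Defs
begin

text \<open>
  The Rayleigh quotient of the up-Laplacian is at most \<open>i + 2\<close>, and \<open>i + 2\<close> is attained exactly if
  the \<open>(i+1)\<close>-faces can be oriented so that any two adjacent ones induce the same orientation
  on their common face.  Necessity follows from a maximum principle: where the absolute value of an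
  eigenfunction is maximal, all terms of the Laplacian must have the same sign and maximal size, and
  path connectedness propagates this to all of \<open>K\<close>.

  Whether such orientations exist is the question whether the signed adjacency graph of the
  \<open>(i+1)\<close>-faces is balanced.  A shortest closed walk of negative sign has no chords, so it
  suffices to look at induced cycles; these are the circuits, and a circuit of length \<open>m\<close> is
  orientable if and only if its sign is \<open>(-1)^m\<close>.
\<close>

section \<open>Alternating functions\<close>

text \<open>The constant \<open>i + 2\<close> is the number of vertices of an
  \<open>(i+1)\<close>-face. By the normalization, the Laplacian at an \<open>i\<close>-face with
  cofaces is a weighted average over the cofaces of sums of \<open>i + 2\<close> signed values of
  \<open>f\<close>, one for each \<open>i\<close>-face of the coface. This gives the bound and
  explains the rigidity when it is attained. At an \<open>i\<close>-face that is a facet the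
  Laplacian vanishes, so an eigenfunction for \<open>i + 2\<close> is 0 there.

  The eigenvalue asks for induced orientations that agree, orientability for opposite ones; a
  parameter \<open>e\<close>, 1 or -1, covers both. Reversing the orientation of one face flips the
  signs of all edges at it, which leaves the sign of every closed walk unchanged. On an induced
  cycle of length \<open>m\<close> all edge signs can be made equal to \<open>e\<close> exactly if
  the cycle has sign \<open>e ^ m\<close>; comparing the two values of \<open>e\<close> produces the
  parity condition.\<close>

lemma some_ordering_in: "finite F \<Longrightarrow> some_ordering F \<in> orderings F"
  unfolding some_ordering_def orderings_def
  by (rule someI_ex) (use finite_distinct_list in auto)

lemma orderings_permutes:
  assumes "xs \<in> orderings F" "ys \<in> orderings F"
  obtains p where "p permutes F" "map p xs = ys"
proof -
  let ?n = "length xs"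
  have d: "distinct xs" "distinct ys" "set xs = F" "set ys = F"
    using assms by (auto simp: orderings_def)
  have len: "length ys = ?n"
    using d by (metis distinct_card)
  have bx: "bij_betw (nth xs) {..<?n} F" and byy: "bij_betw (nth ys) {..<?n} F"
    using d len by (auto intro: bij_betw_nth)
  define q where "q = nth ys \<circ> inv_into {..<?n} (nth xs)"
  define p where "p = (\<lambda>x. if x \<in> F then q x else x)"
  have "bij_betw q F F"
    unfolding q_def using bij_betw_trans[OF bij_betw_inv_into[OF bx] byy] .
  then have "p permutes F"
    by (intro bij_imp_permutes) (auto simp: p_def cong: bij_betw_cong)
  moreover have "map p xs = ys"
  proof (rule nth_equalityI)
    fix k assume k: "k < length (map p xs)"
    then have "xs ! k \<in> F" using d(3) nth_mem[of k xs] by simp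
    then show "map p xs ! k = ys ! k"
      using k bij_betw_inv_into_left[OF bx] by (simp add: p_def q_def)
  qed (simp add: len)
  ultimately show ?thesis by (rule that)
qed

lemma map_permutes_orderings:
  "xs \<in> orderings F \<Longrightarrow> p permutes F \<Longrightarrow> map p xs \<in> orderings F"
  by (auto simp: orderings_def distinct_map permutes_image inj_on_subset[OF permutes_inj])

lemma alternating_onD:
  "alternating_on F f \<Longrightarrow> xs \<in> orderings F \<Longrightarrow> p permutes F \<Longrightarrow> f (map p xs) = of_int (sign p) * f xs"
  by (simp add: alternating_on_def)

lemma alternating_on_swap:
  assumes "alternating_on F f" "A @ x # y # B \<in> orderings F"
  shows "f (A @ y # x # B) = - f (A @ x # y # B)"
proof -
  have d: "distinct (A @ x # y # B)" "set (A @ x # y # B) = F"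
    using assms(2) by (auto simp: orderings_def)
  have "transpose x y permutes F"
    using d by (intro permutes_swap_id) auto
  moreover have "map (transpose x y) (A @ x # y # B) = A @ y # x # B"
    using d(1) by (auto simp: transpose_def intro!: map_idI)
  moreover have "sign (transpose x y) = -1"
    using d(1) by (simp add: sign_swap_id)
  ultimately show ?thesis
    using alternating_onD[OF assms] by fastforce
qed

text \<open>Adjacent swaps generate all permutations. The criterion suits functions such as
  \<open>cone\<close>, whose sign is read off from a position in the list.\<close>

lemma alternating_onI:
  fixes f :: "'a list \<Rightarrow> 'b::ring_1"
  assumes swap: "\<And>A x y B. A @ x # y # B \<in> orderings F \<Longrightarrow> f (A @ y # x # B) = - f (A @ x # y # B)"
  shows "alternating_on F f"
proof -
  have move: "f (A @ B @ x # C) = (-1) ^ length B * f (A @ x # B @ C)"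
    if "A @ x # B @ C \<in> orderings F" for A B C x
    using that
  proof (induction B arbitrary: A)
    case (Cons b B)
    have "(A @ [b]) @ x # B @ C \<in> orderings F"
      using Cons.prems by (auto simp: orderings_def)
    from Cons.IH[OF this] show ?case
      using swap[of A x b "B @ C"] Cons.prems by simp
  qed simp
  \<comment> \<open>Moving the first of the two entries past \<open>B\<close> costs the same sign in
    both lists and leaves two lists that differ by one adjacent swap.\<close>
  have flip: "f (A @ y # B @ x # C) = - f (A @ x # B @ y # C)"
    if o: "A @ x # B @ y # C \<in> orderings F" for A B C x y
  proof -
    have "f (A @ B @ x # y # C) = (-1) ^ length B * f (A @ x # B @ y # C)"
      using move[of A x B "y # C"] o by simp
    moreover have "f (A @ B @ y # x # C) = (-1) ^ length B * f (A @ y # B @ x # C)"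
      using move[of A y B "x # C"] o by (auto simp: orderings_def)
    moreover have "f (A @ B @ y # x # C) = - f (A @ B @ x # y # C)"
      using swap[of "A @ B" x y C] o by (auto simp: orderings_def)
    ultimately have "(-1) ^ length B * f (A @ y # B @ x # C) = (-1) ^ length B * (- f (A @ x # B @ y # C))"
      by simp
    \<comment> \<open>A general ring allows no cancellation, so the factor is removed by
      parity.\<close>
    then show ?thesis
      by (cases "even (length B)") (simp, simp, metis minus_minus)
  qed
  have trans: "f (map (transpose a b) xs) = - f xs"
    if xs: "xs \<in> orderings F" and ab: "a \<in> F" "b \<in> F" "a \<noteq> b" for xs a b
  proof -
    have main: "f (map (transpose a b) (A @ a # B @ b # C)) = - f (A @ a # B @ b # C)"
      if "A @ a # B @ b # C \<in> orderings F" for A B C a b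
    proof -
      have "map (transpose a b) (A @ a # B @ b # C) = A @ b # B @ a # C"
        using that by (auto simp: orderings_def transpose_def intro!: map_idI)
      then show ?thesis using flip[OF that] by simp
    qed
    obtain A D where AD: "xs = A @ a # D"
      using xs ab split_list[of a xs] by (auto simp: orderings_def)
    show ?thesis
    proof (cases "b \<in> set D")
      case True
      then obtain B C where "D = B @ b # C" by (meson split_list)
      then show ?thesis using main[of A a B b C] xs AD by simp
    next
      case False
      then have "b \<in> set A" using xs ab AD by (auto simp: orderings_def)
      then obtain B C where "A = B @ b # C" by (meson split_list)
      then show ?thesis
        using main[of B b C a D] xs AD by (simp add: transpose_commute)
    qed
  qed
  show ?thesis
    unfolding alternating_on_def
  proof (intro ballI allI impI)
    fix xs p assume xs: "xs \<in> orderings F" and p: "p permutes F"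
    have "finite F" using xs by (auto simp: orderings_def)
    from p this show "f (map p xs) = of_int (sign p) * f xs"
    proof (induction rule: permutes_induct)
      case id
      then show ?case by (simp add: sign_id)
    next
      case (swap a b q)
      show ?case
      proof (cases "a = b")
        case True
        then show ?thesis using swap by simp
      next
        case False
        have "sign (transpose a b \<circ> q) = - sign q"
          using False permutes_imp_permutation[OF \<open>finite F\<close> \<open>q permutes F\<close>]
          by (simp add: sign_compose permutation_swap_id sign_swap_id)
        moreover have "f (map (transpose a b \<circ> q) xs) = - f (map q xs)"
          using trans[OF map_permutes_orderings[OF xs \<open>q permutes F\<close>] swap(1,2) False]
          by (simp only: map_map)
        ultimately show ?thesis
          using swap.IH by (simp only: of_int_minus mult_minus_left)
      qed
    qed
  qed
qed

text \<open>Both factors change by the same sign, whose square is 1. This makes every choice through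
  \<open>some_ordering\<close> harmless.\<close>

lemma alternating_prod_eq:
  fixes f g :: "'a list \<Rightarrow> 'b::comm_ring_1"
  assumes "alternating_on F f" "alternating_on F g" "xs \<in> orderings F" "ys \<in> orderings F"
  shows "f ys * g ys = f xs * g xs"
proof -
  obtain p where p: "p permutes F" "map p xs = ys"
    using orderings_permutes assms by metis
  have "f ys * g ys = of_int (sign p * sign p) * (f xs * g xs)"
    unfolding p(2)[symmetric] alternating_onD[OF assms(1,3) p(1)] alternating_onD[OF assms(2,3) p(1)]
    by (simp only: of_int_mult mult_ac)
  then show ?thesis by simp
qed

text \<open>Alternating functions on one face have a single degree of freedom, so identities between
  cones can be checked at an ordering that begins with a convenient vertex.\<close>

lemma alternating_eqI:
  fixes f g :: "'a list \<Rightarrow> 'b::comm_ring_1"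
  assumes "alternating_on F f" "alternating_on F g" "xs \<in> orderings F" "ys \<in> orderings F" "f xs = g xs"
  shows "f ys = g ys"
proof -
  obtain p where "p permutes F" "map p xs = ys"
    using orderings_permutes assms by metis
  then show ?thesis
    using alternating_onD[OF assms(1,3)] alternating_onD[OF assms(2,3)] assms(5) by metis
qed

lemma alternating_abs_eq:
  fixes f :: "'a list \<Rightarrow> 'b::linordered_idom"
  assumes "alternating_on F f" "xs \<in> orderings F" "ys \<in> orderings F"
  shows "\<bar>f ys\<bar> = \<bar>f xs\<bar>"
  using alternating_prod_eq[OF assms(1,1,2,3)] by (simp add: abs_eq_iff square_eq_iff)

text \<open>
  For \<open>f\<close> alternating on \<open>F - {v}\<close>, this is the alternating function on \<open>F\<close> that is
  \<open>f ys\<close> at \<open>v # ys\<close>.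
\<close>

definition cone :: "'a \<Rightarrow> ('a list \<Rightarrow> 'b::ring_1) \<Rightarrow> 'a list \<Rightarrow> 'b" where
  "cone v f xs = (-1) ^ length (takeWhile (\<lambda>x. x \<noteq> v) xs) * f (remove1 v xs)"

lemma cone_Cons [simp]: "cone v f (v # ys) = f ys"
  by (simp add: cone_def)

lemma remove1_orderings: "xs \<in> orderings F \<Longrightarrow> remove1 v xs \<in> orderings (F - {v})"
  by (auto simp: orderings_def)

lemma Cons_orderings: "ys \<in> orderings E \<Longrightarrow> v \<notin> E \<Longrightarrow> v # ys \<in> orderings (insert v E)"
  by (auto simp: orderings_def)

lemma Cons_orderings_iff: "v # ys \<in> orderings F \<longleftrightarrow> v \<in> F \<and> ys \<in> orderings (F - {v})"
  by (auto simp: orderings_def)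

text \<open>A swap involving \<open>v\<close> moves it by one position and does not affect the list
  without \<open>v\<close>. Any other adjacent swap keeps the position of \<open>v\<close> and
  remains an adjacent swap once \<open>v\<close> is removed.\<close>

lemma alternating_on_cone:
  fixes f :: "'a list \<Rightarrow> 'b::ring_1"
  assumes "alternating_on (F - {v}) f" "v \<in> F"
  shows "alternating_on F (cone v f)"
proof (rule alternating_onI)
  fix A x y B assume o: "A @ x # y # B \<in> orderings F"
  have d: "distinct (A @ x # y # B)" using o by (simp add: orderings_def)
  have r: "remove1 v (A @ x # y # B) \<in> orderings (F - {v})"
    using o by (rule remove1_orderings)
  consider "v = x" | "v = y" | "v \<in> set A" | "v \<in> set B" "v \<notin> set A" "v \<noteq> x" "v \<noteq> y"
    using o assms(2) by (auto simp: orderings_def)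
  then show "cone v f (A @ y # x # B) = - cone v f (A @ x # y # B)"
  proof cases
    case 1
    have "v \<notin> set A" "v \<noteq> y" using d 1 by auto
    then have "takeWhile (\<lambda>x. x \<noteq> v) (A @ y # x # B) = A @ [y]"
      "takeWhile (\<lambda>x. x \<noteq> v) (A @ x # y # B) = A"
      using 1 by (auto simp: takeWhile_append)
    then show ?thesis using \<open>v \<notin> set A\<close> \<open>v \<noteq> y\<close> 1 by (simp add: cone_def remove1_append)
  next
    case 2
    have "v \<notin> set A" "v \<noteq> x" using d 2 by auto
    then have "takeWhile (\<lambda>x. x \<noteq> v) (A @ x # y # B) = A @ [x]"
      "takeWhile (\<lambda>x. x \<noteq> v) (A @ y # x # B) = A"
      using 2 by (auto simp: takeWhile_append)
    then show ?thesis using \<open>v \<notin> set A\<close> \<open>v \<noteq> x\<close> 2 by (simp add: cone_def remove1_append)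
  next
    case 3
    have "takeWhile (\<lambda>x. x \<noteq> v) (A @ C) = takeWhile (\<lambda>x. x \<noteq> v) A" for C
      using 3 by (intro takeWhile_append1) auto
    then show ?thesis
      using 3 alternating_on_swap[OF assms(1), of "remove1 v A" x y B] r
      by (simp add: cone_def remove1_append)
  next
    case 4
    have "takeWhile (\<lambda>x. x \<noteq> v) (A @ C) = A @ takeWhile (\<lambda>x. x \<noteq> v) C" for C
      using 4(2) by (intro takeWhile_append2) auto
    then show ?thesis
      using 4 alternating_on_swap[OF assms(1), of A x y "remove1 v B"] r
      by (simp add: cone_def remove1_append)
  qed
qed

text \<open>A permutation of \<open>F - {v}\<close> is a permutation of \<open>F\<close> that fixes
  \<open>v\<close>, with the same sign.\<close>

lemma alternating_on_link:
  assumes "alternating_on F f" "v \<in> F"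
  shows "alternating_on (F - {v}) (\<lambda>ys. f (v # ys))"
  unfolding alternating_on_def
proof (intro ballI allI impI)
  fix ys p assume ys: "ys \<in> orderings (F - {v})" and p: "p permutes (F - {v})"
  have "p permutes F" using permutes_subset[OF p] by blast
  moreover have "p v = v" using permutes_not_in[OF p] by blast
  moreover have "v # ys \<in> orderings F" using ys assms(2) by (simp add: Cons_orderings_iff)
  ultimately show "f (v # map p ys) = of_int (sign p) * f (v # ys)"
    using alternating_onD[OF assms(1), of "v # ys" p] by simp
qed

lemma alternating_on_sum:
  "(\<And>v. v \<in> A \<Longrightarrow> alternating_on F (f v)) \<Longrightarrow> alternating_on F (\<lambda>xs. \<Sum>v\<in>A. f v xs)"
  by (simp add: alternating_on_def sum_distrib_left)

lemma alternating_on_scale: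
  "alternating_on F f \<Longrightarrow> alternating_on F (\<lambda>xs. (c::'b::comm_ring_1) * f xs)"
  by (simp add: alternating_on_def mult.left_commute)

lemma alternating_on_cong:
  assumes "\<And>xs. xs \<in> orderings F \<Longrightarrow> f xs = g xs"
  shows "alternating_on F f \<longleftrightarrow> alternating_on F g"
  using assms map_permutes_orderings by (fastforce simp: alternating_on_def)

text \<open>The vertices carry no order from which to take an orientation; it is built by coning
  with one vertex after the other.\<close>

lemma ex_face_orientation:
  assumes "finite F"
  shows "\<exists>a. face_orientation F a"
  using assms
proof (induction F)
  case empty
  have "orderings {} = {[]}" by (auto simp: orderings_def)
  then have "face_orientation {} (\<lambda>xs. if xs = [] then 1 else 0)"
    by (auto simp: face_orientation_def alternating_on_def permutes_empty sign_id)
  then show ?case by blast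
next
  case (insert v F)
  then obtain a where a: "face_orientation F a" by blast
  define b where "b = (\<lambda>xs. if xs \<in> orderings (insert v F) then cone v a xs else 0)"
  have F: "insert v F - {v} = F" using insert by simp
  have "alternating_on (insert v F) (cone v a)"
    using a by (intro alternating_on_cone) (auto simp: F face_orientation_def)
  then have "alternating_on (insert v F) b"
    by (subst alternating_on_cong[where g = "cone v a"]) (simp_all add: b_def)
  moreover have "b xs \<in> {1, -1}" if "xs \<in> orderings (insert v F)" for xs
  proof -
    have "a (remove1 v xs) \<in> {1, -1}"
      using remove1_orderings[OF that, of v] a unfolding F face_orientation_def by blast
    then show ?thesis
      using that by (cases "even (length (takeWhile (\<lambda>x. x \<noteq> v) xs))") (auto simp: b_def cone_def)
  qed
  ultimately have "face_orientation (insert v F) b"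
    by (auto simp: face_orientation_def b_def)
  then show ?case by blast
qed

text \<open>\<open>cone\<close> at the \<open>j\<close>-th entry carries exactly the sign
  \<open>(-1) ^ j\<close>. Indexing by vertices instead of positions makes each summand alternating
  on \<open>G\<close> by itself.\<close>

lemma coboundary_eq_sum_cone:
  assumes "xs \<in> orderings G" "G \<in> faces K (i + 1)"
  shows "coboundary K i f xs = (\<Sum>v\<in>G. cone v f xs)"
proof -
  have d: "distinct xs" "set xs = G" using assms by (auto simp: orderings_def)
  have b: "bij_betw (nth xs) {..<length xs} G"
    using d by (auto intro: bij_betw_nth)
  have "cone (xs ! j) f xs = (-1) ^ j * f (take j xs @ drop (Suc j) xs)" if j: "j < length xs" for j
  proof -
    have xs: "xs = take j xs @ xs ! j # drop (Suc j) xs" using j by (rule id_take_nth_drop)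
    have "distinct (take j xs @ xs ! j # drop (Suc j) xs)"
      using d(1) by (simp only: xs[symmetric])
    then have n: "xs ! j \<notin> set (take j xs)" by simp
    have "takeWhile (\<lambda>x. x \<noteq> xs ! j) xs = take j xs"
      using n by (subst (2) xs) (subst takeWhile_append2; auto)
    moreover have "remove1 (xs ! j) xs = take j xs @ drop (Suc j) xs"
      using n by (subst (2) xs) (simp add: remove1_append)
    ultimately show ?thesis using j by (simp add: cone_def)
  qed
  then have "(\<Sum>j<length xs. (-1) ^ j * f (take j xs @ drop (Suc j) xs))
      = (\<Sum>j<length xs. cone (xs ! j) f xs)" by simp
  also have "\<dots> = (\<Sum>v\<in>G. cone v f xs)"
    by (rule sum.reindex_bij_betw[OF b])
  finally show ?thesis using assms by (auto simp: coboundary_def)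
qed

section \<open>The adjoint of the coboundary\<close>

lemma abstract_complexD:
  assumes "abstract_complex K"
  shows "finite K" "F \<in> K \<Longrightarrow> finite F" "F \<in> K \<Longrightarrow> G \<subseteq> F \<Longrightarrow> G \<in> K"
  using assms by (auto simp: abstract_complex_def)

lemma finite_faces: "abstract_complex K \<Longrightarrow> finite (faces K i)"
  by (simp add: abstract_complex_def faces_def)

lemma face_finite: "F \<in> faces K i \<Longrightarrow> finite F"
  by (rule card_ge_0_finite) (simp add: faces_def)

lemma faces_Diff:
  assumes "abstract_complex K" "G \<in> faces K (i + 1)" "v \<in> G"
  shows "G - {v} \<in> faces K i"
  using assms abstract_complexD(3)[OF assms(1), of G "G - {v}"] by (auto simp: faces_def)

text \<open>Indexes the cofaces of a face by the added vertex, so that \<open>v # ys\<close> is an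
  ordering of the coface if \<open>ys\<close> is one of the face.\<close>

definition link_vertices :: "'a set set \<Rightarrow> 'a set \<Rightarrow> 'a set" where
  "link_vertices K F = {v. v \<notin> F \<and> insert v F \<in> K}"

lemma insert_link_faces:
  "E \<in> faces K i \<Longrightarrow> v \<in> link_vertices K E \<Longrightarrow> insert v E \<in> faces K (i + 1)"
  using face_finite[of E K i] by (auto simp: faces_def link_vertices_def)

lemma finite_link_vertices:
  assumes "abstract_complex K"
  shows "finite (link_vertices K F)"
proof -
  have "link_vertices K F \<subseteq> \<Union>K" by (auto simp: link_vertices_def)
  moreover have "finite (\<Union>K)" using assms by (auto simp: abstract_complex_def)
  ultimately show ?thesis by (rule finite_subset)
qed

section \<open>Cofaces, degrees and positivity of the weight\<close>

lemma cofaces_eq_image: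
  assumes "finite F"
  shows "cofaces K F = (\<lambda>v. insert v F) ` link_vertices K F"
proof
  show "cofaces K F \<subseteq> (\<lambda>v. insert v F) ` link_vertices K F"
  proof
    fix G assume G: "G \<in> cofaces K F"
    then have "card (G - F) = 1" "F \<subseteq> G" "G \<in> K"
      using assms by (auto simp: cofaces_def card_Diff_subset)
    then obtain v where "G - F = {v}" by (auto simp: card_1_singleton_iff)
    then have "G = insert v F" "v \<notin> F" using \<open>F \<subseteq> G\<close> by auto
    then show "G \<in> (\<lambda>v. insert v F) ` link_vertices K F"
      using \<open>G \<in> K\<close> by (auto simp: link_vertices_def)
  qed
qed (use assms in \<open>auto simp: cofaces_def link_vertices_def\<close>)

lemma face_degree_eq:
  assumes "finite F"
  shows "face_degree K w F = (\<Sum>v\<in>link_vertices K F. w (insert v F))"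
proof -
  have "inj_on (\<lambda>v. insert v F) (link_vertices K F)"
    by (auto simp: inj_on_def link_vertices_def)
  then show ?thesis
    unfolding face_degree_def cofaces_eq_image[OF assms] by (simp add: sum.reindex)
qed

text \<open>By closure under inclusion, any face strictly above \<open>F\<close> contains some face
  \<open>insert v F\<close>.\<close>

lemma is_facet_iff_link_vertices:
  assumes "abstract_complex K" "F \<in> K"
  shows "is_facet K F \<longleftrightarrow> link_vertices K F = {}"
proof
  assume "link_vertices K F = {}"
  moreover have "\<exists>v. v \<in> link_vertices K F" if G: "G \<in> K" "F \<subset> G" for G
  proof -
    obtain v where "v \<in> G" "v \<notin> F" using G by blast
    moreover have "insert v F \<in> K"
      using abstract_complexD(3)[OF assms(1) G(1)] G \<open>v \<in> G\<close> by auto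
    ultimately show ?thesis by (auto simp: link_vertices_def)
  qed
  ultimately show "is_facet K F" using assms by (auto simp: is_facet_def)
qed (auto simp: is_facet_def link_vertices_def)

lemma normalized_weight_pos:
  "abstract_complex K \<Longrightarrow> F \<in> K \<Longrightarrow> 0 < normalized_weight K F"
proof (induction K F rule: normalized_weight.induct)
  case (1 K F)
  show ?case
  proof (cases "is_facet K F")
    case True
    then show ?thesis using 1 by (simp add: normalized_weight_facet)
  next
    case False
    have "finite F" using 1 by (auto simp: abstract_complex_def)
    moreover have "link_vertices K F \<noteq> {}"
      using False 1 is_facet_iff_link_vertices by blast
    moreover have "finite K" using 1 by (simp add: abstract_complex_def)
    moreover have "0 < normalized_weight K (insert v F)" if "v \<in> link_vertices K F" for v
      using 1 False that \<open>finite K\<close> \<open>finite F\<close>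
      by (intro "1.IH") (auto simp: cofaces_eq_image link_vertices_def)
    ultimately have "0 < (\<Sum>v\<in>link_vertices K F. normalized_weight K (insert v F))"
      using finite_link_vertices[OF \<open>abstract_complex K\<close>] by (intro sum_pos) auto
    then show ?thesis
      using 1 False \<open>finite F\<close> by (simp add: normalized_weight_nonfacet face_degree_eq)
  qed
qed

section \<open>Cochain spaces and the coboundary map\<close>

lemma cochains_alternating: "f \<in> cochains K i \<Longrightarrow> F \<in> faces K i \<Longrightarrow> alternating_on F f"
  by (simp add: cochains_def)

lemma cochains_eq_0: "f \<in> cochains K i \<Longrightarrow> xs \<notin> \<Union>(orderings ` faces K i) \<Longrightarrow> f xs = 0"
  unfolding cochains_def by blast

lemma cochains_ext:
  assumes "f \<in> cochains K i" "g \<in> cochains K i"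
    and "\<And>F xs. F \<in> faces K i \<Longrightarrow> xs \<in> orderings F \<Longrightarrow> f xs = g xs"
  shows "f = g"
proof
  fix xs show "f xs = g xs"
    using assms cochains_eq_0[of f K i xs] cochains_eq_0[of g K i xs]
    by (cases "xs \<in> \<Union>(orderings ` faces K i)") auto
qed

lemma alternating_on_diff:
  "alternating_on F f \<Longrightarrow> alternating_on F g \<Longrightarrow> alternating_on F (\<lambda>xs. f xs - g xs)"
  by (simp add: alternating_on_def right_diff_distrib)

lemma cochains_diff:
  "f \<in> cochains K i \<Longrightarrow> g \<in> cochains K i \<Longrightarrow> (\<lambda>xs. f xs - g xs) \<in> cochains K i"
  by (simp add: cochains_def alternating_on_diff)

lemma cochains_scale:
  "f \<in> cochains K i \<Longrightarrow> (\<lambda>xs. c * f xs) \<in> cochains K i"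
  by (simp add: cochains_def alternating_on_scale)

lemma coboundary_cochains:
  assumes "abstract_complex K" "f \<in> cochains K i"
  shows "coboundary K i f \<in> cochains K (i + 1)"
proof -
  have "alternating_on G (coboundary K i f)" if G: "G \<in> faces K (i + 1)" for G
  proof -
    have "alternating_on G (\<lambda>xs. \<Sum>v\<in>G. cone v f xs)"
      using faces_Diff[OF assms(1) G] assms(2)
      by (intro alternating_on_sum alternating_on_cone) (auto intro: cochains_alternating)
    then show ?thesis
      using G by (subst alternating_on_cong[where g = "\<lambda>xs. \<Sum>v\<in>G. cone v f xs"])
        (auto simp: coboundary_eq_sum_cone)
  qed
  then show ?thesis
    by (auto simp: cochains_def coboundary_def)
qed

text \<open>Found by comparing the coefficients of \<open>f\<close> on the two sides of the
  adjointness equation. The incidence sign is absorbed by evaluating \<open>g\<close> with the new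
  vertex in front.\<close>

definition explicit_adjoint ::
  "'a set set \<Rightarrow> ('a set \<Rightarrow> real) \<Rightarrow> nat \<Rightarrow> ('a list \<Rightarrow> real) \<Rightarrow> 'a list \<Rightarrow> real" where
  "explicit_adjoint K w i g ys =
     (if ys \<in> \<Union>(orderings ` faces K i)
      then 1 / w (set ys) * (\<Sum>v\<in>link_vertices K (set ys). w (insert v (set ys)) * g (v # ys))
      else 0)"

lemma explicit_adjoint_eq:
  "E \<in> faces K i \<Longrightarrow> ys \<in> orderings E \<Longrightarrow>
     explicit_adjoint K w i g ys = 1 / w E * (\<Sum>v\<in>link_vertices K E. w (insert v E) * g (v # ys))"
  unfolding explicit_adjoint_def by (auto simp: orderings_def)

lemma explicit_adjoint_cochains:
  assumes "g \<in> cochains K (i + 1)"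
  shows "explicit_adjoint K w i g \<in> cochains K i"
proof -
  have "alternating_on E (explicit_adjoint K w i g)" if E: "E \<in> faces K i" for E
  proof -
    have "alternating_on E (\<lambda>ys. g (v # ys))" if v: "v \<in> link_vertices K E" for v
    proof -
      have "insert v E - {v} = E" using v by (auto simp: link_vertices_def)
      then show ?thesis
        using alternating_on_link[of "insert v E" g v]
          cochains_alternating[OF assms insert_link_faces[OF E v]] by simp
    qed
    then have "alternating_on E
        (\<lambda>ys. 1 / w E * (\<Sum>v\<in>link_vertices K E. w (insert v E) * g (v # ys)))"
      by (intro alternating_on_scale alternating_on_sum)
    then show ?thesis
      by (subst alternating_on_cong[OF explicit_adjoint_eq[OF E]])
  qed
  then show ?thesis by (auto simp: cochains_def explicit_adjoint_def)
qed

text \<open>Double counting of incident pairs: a face \<open>G\<close> with a vertex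
  \<open>v\<close> in it corresponds to the face \<open>E = G - {v}\<close> with \<open>v\<close> in
  its link. Both inner products are the sum of \<open>t E v\<close> over these pairs.\<close>

lemma cochain_inner_explicit_adjoint:
  assumes K: "abstract_complex K" and w: "\<forall>F\<in>K. 0 < w F"
    and f: "f \<in> cochains K i" and g: "g \<in> cochains K (i + 1)"
  shows "cochain_inner K w (i + 1) (coboundary K i f) g = cochain_inner K w i f (explicit_adjoint K w i g)"
proof -
  define t where "t = (\<lambda>E v. w (insert v E) * (f (some_ordering E) * g (v # some_ordering E)))"
  have "cochain_inner K w (i + 1) (coboundary K i f) g = (\<Sum>G\<in>faces K (i + 1). \<Sum>v\<in>G. t (G - {v}) v)"
    unfolding cochain_inner_def
  proof (rule sum.cong[OF refl])
    fix G assume G: "G \<in> faces K (i + 1)"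
    note o = some_ordering_in[OF face_finite[OF G]]
    \<comment> \<open>Both factors alternate on \<open>G\<close>, so their product may be evaluated
      at an ordering that begins with \<open>v\<close>, where the cone is just
      \<open>f\<close>.\<close>
    have "cone v f (some_ordering G) * g (some_ordering G) =
        f (some_ordering (G - {v})) * g (v # some_ordering (G - {v}))" if v: "v \<in> G" for v
    proof -
      have "v # some_ordering (G - {v}) \<in> orderings G"
        using v some_ordering_in[of "G - {v}"] face_finite[OF G] by (simp add: Cons_orderings_iff)
      moreover have "alternating_on G (cone v f)"
        by (intro alternating_on_cone cochains_alternating[OF f] faces_Diff[OF K G v] v)
      ultimately show ?thesis
        using alternating_prod_eq[OF _ cochains_alternating[OF g G] _ o, of "cone v f"]
        by fastforce
    qed
    then show "w G * coboundary K i f (some_ordering G) * g (some_ordering G) = (\<Sum>v\<in>G. t (G - {v}) v)"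
      unfolding coboundary_eq_sum_cone[OF o G]
      by (simp add: t_def sum_distrib_left sum_distrib_right insert_absorb mult.assoc)
  qed
  also have "\<dots> = (\<Sum>(G, v)\<in>(SIGMA G:faces K (i + 1). G). t (G - {v}) v)"
    using K by (intro sum.Sigma) (auto simp: finite_faces intro: face_finite)
  also have "\<dots> = (\<Sum>(E, v)\<in>(SIGMA E:faces K i. link_vertices K E). t E v)"
  proof (rule sum.reindex_bij_witness[where i = "\<lambda>(E, v). (insert v E, v)" and j = "\<lambda>(G, v). (G - {v}, v)"],
      goal_cases)
    case (2 a)
    then obtain G v where a: "a = (G, v)" "G \<in> faces K (i + 1)" "v \<in> G" by auto
    then have "v \<in> link_vertices K (G - {v})"
      by (auto simp: link_vertices_def insert_absorb faces_def)
    then show ?case using a faces_Diff[OF K] by simp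
  next
    case (4 b)
    then obtain E v where "b = (E, v)" "E \<in> faces K i" "v \<in> link_vertices K E" by auto
    then show ?case using insert_link_faces[of E K i v] by simp
  qed (auto simp: link_vertices_def)
  also have "\<dots> = (\<Sum>E\<in>faces K i. \<Sum>v\<in>link_vertices K E. t E v)"
    using K by (intro sum.Sigma[symmetric]) (auto simp: finite_faces finite_link_vertices)
  also have "\<dots> = cochain_inner K w i f (explicit_adjoint K w i g)"
    unfolding cochain_inner_def
  proof (rule sum.cong[OF refl])
    fix E assume E: "E \<in> faces K i"
    have "w E \<noteq> 0" using w E by (force simp: faces_def)
    then show "(\<Sum>v\<in>link_vertices K E. t E v) =
        w E * f (some_ordering E) * explicit_adjoint K w i g (some_ordering E)"
      unfolding explicit_adjoint_eq[OF E some_ordering_in[OF face_finite[OF E]]]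
      by (simp add: t_def sum_distrib_left mult_ac)
  qed
  finally show ?thesis .
qed

lemma cochain_inner_self_eq_0:
  assumes K: "abstract_complex K" and w: "\<forall>F\<in>K. 0 < w F"
    and f: "f \<in> cochains K i" and 0: "cochain_inner K w i f f = 0"
  shows "f = (\<lambda>_. 0)"
proof (rule cochains_ext[OF f])
  show "(\<lambda>_. 0) \<in> cochains K i" by (simp add: cochains_def alternating_on_def)
  fix F xs assume F: "F \<in> faces K i" and xs: "xs \<in> orderings F"
  have "w F * f (some_ordering F) * f (some_ordering F) = 0"
  proof (rule sum_nonneg_0[OF finite_faces[OF K] _ 0[unfolded cochain_inner_def] F])
    fix F assume "F \<in> faces K i"
    then have "0 \<le> w F" using w by (auto simp: faces_def less_imp_le)
    then show "0 \<le> w F * f (some_ordering F) * f (some_ordering F)"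
      by (simp add: mult.assoc)
  qed
  moreover have "w F \<noteq> 0" using w F by (force simp: faces_def)
  ultimately have "f (some_ordering F) = 0" by simp
  then show "f xs = 0"
    using alternating_abs_eq[OF cochains_alternating[OF f F] xs some_ordering_in[OF face_finite[OF F]]]
    by simp
qed

text \<open>For uniqueness, two candidates are tested against their own difference \<open>d\<close>,
  which then has norm 0.\<close>

lemma coboundary_adjoint_eq:
  assumes K: "abstract_complex K" and w: "\<forall>F\<in>K. 0 < w F"
    and g: "g \<in> cochains K (i + 1)"
  shows "coboundary_adjoint K w i g = explicit_adjoint K w i g"
  unfolding coboundary_adjoint_def
proof (rule the_equality, intro conjI ballI)
  show a: "explicit_adjoint K w i g \<in> cochains K i"
    using g by (rule explicit_adjoint_cochains)
  show "cochain_inner K w (i + 1) (coboundary K i f) g = cochain_inner K w i f (explicit_adjoint K w i g)"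
    if "f \<in> cochains K i" for f
    using K w that g by (rule cochain_inner_explicit_adjoint)
  fix h assume h: "h \<in> cochains K i \<and>
    (\<forall>f\<in>cochains K i. cochain_inner K w (i + 1) (coboundary K i f) g = cochain_inner K w i f h)"
  define d where "d = (\<lambda>xs. h xs - explicit_adjoint K w i g xs)"
  have d: "d \<in> cochains K i" using h a by (simp add: d_def cochains_diff)
  have "cochain_inner K w i d d = cochain_inner K w i d h - cochain_inner K w i d (explicit_adjoint K w i g)"
    by (subst (2) d_def) (simp add: cochain_inner_def right_diff_distrib sum_subtractf)
  then have "cochain_inner K w i d d = 0"
    using h d cochain_inner_explicit_adjoint[OF K w d g] by simp
  from cochain_inner_self_eq_0[OF K w d this]
  show "h = explicit_adjoint K w i g" by (auto simp: d_def fun_eq_iff)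
qed

lemma up_laplacian_cochains:
  assumes "abstract_complex K" "\<forall>F\<in>K. 0 < w F" "f \<in> cochains K i"
  shows "up_laplacian K w i f \<in> cochains K i"
  unfolding up_laplacian_def
  using assms by (simp add: coboundary_adjoint_eq coboundary_cochains[simplified] explicit_adjoint_cochains)

text \<open>The summand with \<open>u = v\<close> is \<open>f ys\<close> itself; the other summands
  are signed values of \<open>f\<close> on the remaining \<open>i\<close>-faces of
  \<open>insert v E\<close>.\<close>

lemma up_laplacian_eq:
  assumes K: "abstract_complex K" and w: "\<forall>F\<in>K. 0 < w F" and f: "f \<in> cochains K i"
    and E: "E \<in> faces K i" and ys: "ys \<in> orderings E"
  shows "w E * up_laplacian K w i f ys =
    (\<Sum>v\<in>link_vertices K E. w (insert v E) * (\<Sum>u\<in>insert v E. cone u f (v # ys)))"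
proof -
  have "w E \<noteq> 0" using w E by (force simp: faces_def)
  moreover have "coboundary K i f (v # ys) = (\<Sum>u\<in>insert v E. cone u f (v # ys))"
    if "v \<in> link_vertices K E" for v
    using that ys by (intro coboundary_eq_sum_cone insert_link_faces[OF E] Cons_orderings)
      (auto simp: link_vertices_def)
  ultimately show ?thesis
    unfolding up_laplacian_def coboundary_adjoint_eq[OF K w coboundary_cochains[OF K f]]
      explicit_adjoint_eq[OF E ys]
    by simp
qed

section \<open>Coherent orientations and the eigenvalue\<close>

text \<open>For \<open>e = -1\<close> this is orientability; for \<open>e = 1\<close> adjacent faces
  induce equal orientations, the condition that belongs to the eigenvalue
  \<open>i + 2\<close>.\<close>

definition coherently_orientable :: "int \<Rightarrow> 'a set set \<Rightarrow> nat \<Rightarrow> bool" where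
  "coherently_orientable e L i \<longleftrightarrow>
     (\<exists>a. (\<forall>F\<in>faces L (i + 1). face_orientation F (a F)) \<and>
        (\<forall>F\<in>faces L (i + 1). \<forall>G\<in>faces L (i + 1). \<forall>u v.
           F \<noteq> G \<and> F \<inter> G \<in> faces L i \<and> F - G = {u} \<and> G - F = {v} \<longrightarrow>
             (\<forall>ys\<in>orderings (F \<inter> G). a F (u # ys) = e * a G (v # ys))))"

lemma coherently_orientableI:
  assumes "\<And>F. F \<in> faces L (i + 1) \<Longrightarrow> face_orientation F (a F)"
    and "\<And>F G u v ys. F \<in> faces L (i + 1) \<Longrightarrow> G \<in> faces L (i + 1) \<Longrightarrow> F \<noteq> G \<Longrightarrow>
      F \<inter> G \<in> faces L i \<Longrightarrow> F - G = {u} \<Longrightarrow> G - F = {v} \<Longrightarrow> ys \<in> orderings (F \<inter> G) \<Longrightarrow>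
      a F (u # ys) = e * a G (v # ys)"
  shows "coherently_orientable e L i"
  unfolding coherently_orientable_def
  by (intro exI[of _ a] conjI ballI allI impI; (elim conjE)?) (simp_all add: assms del: One_nat_def)

lemma coherently_orientableE:
  assumes "coherently_orientable e L i"
  obtains a where "\<And>F. F \<in> faces L (i + 1) \<Longrightarrow> face_orientation F (a F)"
    and "\<And>F G u v ys. F \<in> faces L (i + 1) \<Longrightarrow> G \<in> faces L (i + 1) \<Longrightarrow> F \<noteq> G \<Longrightarrow>
      F \<inter> G \<in> faces L i \<Longrightarrow> F - G = {u} \<Longrightarrow> G - F = {v} \<Longrightarrow> ys \<in> orderings (F \<inter> G) \<Longrightarrow>
      a F (u # ys) = e * a G (v # ys)"
proof -
  obtain a where a: "\<forall>F\<in>faces L (i + 1). face_orientation F (a F)"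
    and c: "\<forall>F\<in>faces L (i + 1). \<forall>G\<in>faces L (i + 1). \<forall>u v.
       F \<noteq> G \<and> F \<inter> G \<in> faces L i \<and> F - G = {u} \<and> G - F = {v} \<longrightarrow>
         (\<forall>ys\<in>orderings (F \<inter> G). a F (u # ys) = e * a G (v # ys))"
    using assms unfolding coherently_orientable_def by blast
  show ?thesis
    by (rule that[of a]) (use a c in \<open>simp_all del: One_nat_def\<close>)
qed

lemma face_orientation_alternating: "face_orientation F a \<Longrightarrow> alternating_on F a"
  by (simp add: face_orientation_def)

lemma face_orientation_values: "face_orientation F a \<Longrightarrow> xs \<in> orderings F \<Longrightarrow> a xs = 1 \<or> a xs = -1"
  by (auto simp: face_orientation_def)

lemma face_orientation_eq_0: "face_orientation F a \<Longrightarrow> xs \<notin> orderings F \<Longrightarrow> a xs = 0"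
  by (simp add: face_orientation_def)

text \<open>\<open>orientable_Suc\<close> compares functions on all lists, but off the orderings of
  \<open>F \<inter> G\<close> both induced orientations are 0.\<close>

lemma orientable_Suc_iff: "orientable_Suc L i \<longleftrightarrow> coherently_orientable (-1) L i"
proof -
  have *: "induced_orientation u a = (\<lambda>ys. - induced_orientation v b ys) \<longleftrightarrow>
      (\<forall>ys\<in>orderings (F \<inter> G). a (u # ys) = -1 * b (v # ys))"
    if "face_orientation F a" "face_orientation G b" "F - G = {u}" "G - F = {v}" for F G a b u v
  proof -
    have "F - {u} = F \<inter> G" "G - {v} = F \<inter> G" "u \<in> F" "v \<in> G" using that(3,4) by auto
    then have "a (u # ys) = 0 \<and> b (v # ys) = 0" if "ys \<notin> orderings (F \<inter> G)" for ys
      using that face_orientation_eq_0[OF \<open>face_orientation F a\<close>, of "u # ys"]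
        face_orientation_eq_0[OF \<open>face_orientation G b\<close>, of "v # ys"]
      by (simp add: Cons_orderings_iff)
    then show ?thesis
      unfolding induced_orientation_def fun_eq_iff by (metis mult_minus1 neg_0_equal_iff_equal)
  qed
  then show ?thesis
    unfolding orientable_Suc_def coherently_orientable_def
    by (intro ex_cong1 conj_cong ball_cong all_cong1 imp_cong refl *) auto
qed

text \<open>Dividing by the weight of \<open>E\<close> therefore turns the Laplacian into an average
  over the cofaces.\<close>

lemma normalized_weight_eq_sum:
  assumes "abstract_complex K" "E \<in> K" "link_vertices K E \<noteq> {}"
  shows "normalized_weight K E = (\<Sum>v\<in>link_vertices K E. normalized_weight K (insert v E))"
  using assms by (subst normalized_weight_nonfacet)
    (auto simp: is_facet_iff_link_vertices face_degree_eq abstract_complexD)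

text \<open>The maximum principle forces the \<open>i + 2\<close> cones of \<open>f\<close> on an
  \<open>(i+1)\<close>-face to coincide and to be nonzero. Their common sign orients the face, and
  at \<open>u # ys\<close> this is the sign of \<open>f ys\<close>, whichever coface is
  considered.\<close>

lemma coherent_of_eigenvalue:
  assumes K: "abstract_complex K" and conn: "path_connected_Suc K i"
    and spec: "real (i + 2) \<in> normalized_up_spectrum K i"
  shows "coherently_orientable 1 K i"
proof -
  let ?w = "normalized_weight K"
  have w: "\<forall>F\<in>K. 0 < ?w F" using K by (simp add: normalized_weight_pos)
  obtain f where f: "f \<in> cochains K i" "f \<noteq> (\<lambda>_. 0)"
    and eig: "up_laplacian K ?w i f = (\<lambda>xs. real (i + 2) * f xs)"
    using spec by (auto simp: normalized_up_spectrum_def)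
  define M where "M = Max ((\<lambda>E. \<bar>f (some_ordering E)\<bar>) ` faces K i)"
  obtain ys0 where ys0: "f ys0 \<noteq> 0" using f(2) by blast
  then obtain E0 where E0: "E0 \<in> faces K i" "ys0 \<in> orderings E0"
    using cochains_eq_0[OF f(1)] by blast
  have some: "\<bar>f ys\<bar> = \<bar>f (some_ordering E)\<bar>" if "E \<in> faces K i" "ys \<in> orderings E" for E ys
    using alternating_abs_eq[OF cochains_alternating[OF f(1) that(1)]]
      some_ordering_in[OF face_finite[OF that(1)]] that(2) by blast
  have le: "\<bar>f ys\<bar> \<le> M" if "E \<in> faces K i" "ys \<in> orderings E" for E ys
    unfolding some[OF that] M_def using that finite_faces[OF K] by (intro Max_ge) auto
  have "M > 0" using le[OF E0] ys0 by simp
  have cone_le: "\<bar>cone u f xs\<bar> \<le> M" if "G \<in> faces K (i + 1)" "xs \<in> orderings G" "u \<in> G" for G xs u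
    using le[OF faces_Diff[OF K that(1,3)] remove1_orderings[OF that(2)]]
    by (simp add: cone_def abs_mult)
  have cone_alt: "alternating_on G (cone u f)" if "G \<in> faces K (i + 1)" "u \<in> G" for G u
    using that cochains_alternating[OF f(1) faces_Diff[OF K that]] by (intro alternating_on_cone)
  note lap = up_laplacian_eq[OF K w f(1), unfolded eig]
  have step: "cone u f (v # ys) = f ys"
    if E: "E \<in> faces K i" and ys: "ys \<in> orderings E" and max: "\<bar>f ys\<bar> = M"
      and v: "v \<in> link_vertices K E" and u: "u \<in> insert v E" for E ys u v
  proof -
    have EK: "E \<in> K" using E by (simp add: faces_def)
    have "link_vertices K E \<noteq> {}" using v by blast
    note wE = normalized_weight_eq_sum[OF K EK this]
    define s where "s = sgn (f ys)"
    have s: "s * f ys = M" "\<bar>s\<bar> = 1" using max \<open>M > 0\<close> by (auto simp: s_def abs_sgn mult.commute abs_sgn_eq)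
    \<comment> \<open>The defect of one term from its largest possible value. Multiplication by
      \<open>s\<close> makes the extremal value equal to \<open>M\<close>, and the eigenvalue
      equation says that the weighted sum of these nonnegative defects is 0.\<close>
    define D where "D = (\<lambda>v u. M - s * cone u f (v # ys))"
    have D0: "0 \<le> D v u" if v: "v \<in> link_vertices K E" and u: "u \<in> insert v E" for u v
    proof -
      have "\<bar>s * cone u f (v # ys)\<bar> \<le> M"
        using cone_le[OF insert_link_faces[OF E v] _ u] v ys s(2)
        by (simp add: abs_mult Cons_orderings link_vertices_def)
      then show ?thesis unfolding D_def by linarith
    qed
    have w0: "0 < ?w (insert v E)" if "v \<in> link_vertices K E" for v
      using w that by (simp add: link_vertices_def)
    have c: "card (insert v E) = i + 2" if "v \<in> link_vertices K E" for v
      using insert_link_faces[OF E that] by (simp add: faces_def)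
    have "(\<Sum>v\<in>link_vertices K E. ?w (insert v E) * (\<Sum>u\<in>insert v E. D v u)) =
        (\<Sum>v\<in>link_vertices K E. ?w (insert v E) * (real (i + 2) * M))
        - s * (\<Sum>v\<in>link_vertices K E. ?w (insert v E) * (\<Sum>u\<in>insert v E. cone u f (v # ys)))"
      unfolding sum_distrib_left[of s] sum_subtractf[symmetric]
    proof (rule sum.cong[OF refl])
      fix v assume v: "v \<in> link_vertices K E"
      have "(\<Sum>u\<in>insert v E. D v u) = real (i + 2) * M - s * (\<Sum>u\<in>insert v E. cone u f (v # ys))"
        unfolding D_def sum_subtractf sum_distrib_left[symmetric] sum_constant c[OF v] by simp
      then show "?w (insert v E) * (\<Sum>u\<in>insert v E. D v u) = ?w (insert v E) * (real (i + 2) * M)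
          - s * (?w (insert v E) * (\<Sum>u\<in>insert v E. cone u f (v # ys)))"
        by (simp add: right_diff_distrib)
    qed
    \<comment> \<open>The normalization evaluates the first sum, the eigenvalue equation the
      second.\<close>
    also have "\<dots> = ?w E * (real (i + 2) * M) - s * (?w E * (real (i + 2) * f ys))"
      using wE by (simp only: lap[OF E ys, symmetric] sum_distrib_right[symmetric])
    also have "\<dots> = ?w E * real (i + 2) * (M - s * f ys)"
      by (simp add: algebra_simps)
    also have "\<dots> = 0" by (simp add: s)
    finally have "(\<Sum>v\<in>link_vertices K E. ?w (insert v E) * (\<Sum>u\<in>insert v E. D v u)) = 0" .
    moreover have "0 \<le> ?w (insert v E) * (\<Sum>u\<in>insert v E. D v u)" if "v \<in> link_vertices K E" for v
      using w0[OF that] D0[OF that] by (intro mult_nonneg_nonneg sum_nonneg) auto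
    ultimately have "?w (insert v E) * (\<Sum>u\<in>insert v E. D v u) = 0"
      using v finite_link_vertices[OF K] by (simp only: sum_nonneg_eq_0_iff)
    then have "(\<Sum>u\<in>insert v E. D v u) = 0" using w0[OF v] by simp
    then have "D v u = 0"
      using D0[OF v] u face_finite[OF E] by (subst (asm) sum_nonneg_eq_0_iff) auto
    then have "s * cone u f (v # ys) = s * f ys" by (simp add: D_def s)
    then show ?thesis using s(2) by auto
  qed
  \<comment> \<open>Here \<open>c\<close> may depend on the ordering but not on \<open>u\<close>.
    Goodness carries the propagation: \<open>up\<close> leads from an extremal \<open>i\<close>-face
    to its cofaces, \<open>down\<close> from a good face to all of its
    \<open>i\<close>-faces.\<close>
  define good where "good = (\<lambda>G. \<forall>xs\<in>orderings G. \<exists>c. \<bar>c\<bar> = M \<and> (\<forall>u\<in>G. cone u f xs = c))"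
  have up: "good G" if E: "E \<in> faces K i" "\<bar>f (some_ordering E)\<bar> = M"
    and G: "G \<in> faces K (i + 1)" "E \<subseteq> G" for E G
  proof -
    have "card (G - E) = 1"
      using E G face_finite[OF E(1)] by (simp add: faces_def card_Diff_subset)
    then obtain v where "G - E = {v}" by (auto simp: card_1_singleton_iff)
    then have v: "G = insert v E" "v \<notin> E" using G(2) by auto
    then have vl: "v \<in> link_vertices K E" using G(1) by (auto simp: link_vertices_def faces_def)
    let ?y = "some_ordering E"
    have y: "?y \<in> orderings E" by (rule some_ordering_in[OF face_finite[OF E(1)]])
    have vy: "v # ?y \<in> orderings G" using v y by (simp add: Cons_orderings)
    have vG: "v \<in> G" using v by simp
    show ?thesis
      unfolding good_def
    proof (intro ballI exI conjI)
      fix xs assume xs: "xs \<in> orderings G"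
      show abs: "\<bar>cone v f xs\<bar> = M"
        using alternating_abs_eq[OF cone_alt[OF G(1) vG] vy xs] E(2) by simp
      fix u assume u: "u \<in> G"
      have "cone u f (v # ?y) = cone v f (v # ?y)"
        using step[OF E(1) y E(2) vl] u v(1) by simp
      then show "cone u f xs = cone v f xs"
        using alternating_eqI[OF cone_alt[OF G(1) u] cone_alt[OF G(1) vG] vy xs] by simp
    qed
  qed
  have down: "\<bar>f ys\<bar> = M" if G: "G \<in> faces K (i + 1)" "good G" and E: "E \<in> faces K i" "E \<subseteq> G"
    and ys: "ys \<in> orderings E" for E G ys
  proof -
    have "card (G - E) = 1"
      using E G face_finite[OF E(1)] by (simp add: faces_def card_Diff_subset)
    then obtain v where "G - E = {v}" by (auto simp: card_1_singleton_iff)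
    then have "v \<in> G" "G - {v} = E" using E by auto
    then have "v # ys \<in> orderings G" using ys by (simp add: Cons_orderings_iff)
    then show ?thesis using G(2) \<open>v \<in> G\<close> unfolding good_def by (metis cone_Cons)
  qed
  obtain E1 where E1: "E1 \<in> faces K i" "\<bar>f (some_ordering E1)\<bar> = M"
  proof -
    have "M \<in> (\<lambda>E. \<bar>f (some_ordering E)\<bar>) ` faces K i"
      unfolding M_def using finite_faces[OF K] E0 by (intro Max_in) auto
    then show ?thesis using that by auto
  qed
  \<comment> \<open>Otherwise the Laplacian would vanish at \<open>E1\<close>, while
    \<open>f\<close> does not and the eigenvalue is nonzero.\<close>
  have "link_vertices K E1 \<noteq> {}"
  proof
    assume "link_vertices K E1 = {}"
    then have "?w E1 * (real (i + 2) * f (some_ordering E1)) = 0"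
      using lap[OF E1(1) some_ordering_in[OF face_finite[OF E1(1)]]] by simp
    moreover have "?w E1 \<noteq> 0" using w E1(1) by (force simp: faces_def)
    ultimately have "f (some_ordering E1) = 0" by simp
    then show False using E1 \<open>M > 0\<close> by simp
  qed
  then obtain v1 where "v1 \<in> link_vertices K E1" by blast
  then have G1: "insert v1 E1 \<in> faces K (i + 1)" "good (insert v1 E1)"
    using insert_link_faces[OF E1(1)] up[OF E1] by auto
  have good: "good G" if G: "G \<in> faces K (i + 1)" for G
  proof -
    have "(insert v1 E1, G) \<in> {(A, B). A \<in> faces K (i + 1) \<and> B \<in> faces K (i + 1) \<and>
                           (\<exists>E\<in>faces K i. E \<subseteq> A \<and> E \<subseteq> B)}\<^sup>*"
      using conn G G1(1) unfolding path_connected_Suc_def by blast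
    then show ?thesis
    proof (induction rule: rtrancl_induct)
      case base
      then show ?case by (rule G1)
    next
      case (step A B)
      then obtain E where E: "E \<in> faces K i" "E \<subseteq> A" "E \<subseteq> B" and
        AB: "A \<in> faces K (i + 1)" "B \<in> faces K (i + 1)" by auto
      show ?case
        using up[OF E(1) down[OF AB(1) step.IH E(1,2) some_ordering_in[OF face_finite[OF E(1)]]] AB(2) E(3)] .
    qed
  qed
  \<comment> \<open>On orderings of an \<open>(i+1)\<close>-face this is the coboundary of
    \<open>f\<close>. It alternates, and on a good face its sign is the sign of every cone.\<close>
  define S where "S = (\<lambda>G xs. \<Sum>u\<in>G. cone u f xs)"
  define a :: "'a set \<Rightarrow> 'a list \<Rightarrow> int" where
    "a = (\<lambda>G xs. if xs \<in> orderings G then (if S G xs > 0 then 1 else -1) else 0)"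
  have S_eq: "S G xs = real (i + 2) * cone u f xs"
    if G: "G \<in> faces K (i + 1)" and xs: "xs \<in> orderings G" and u: "u \<in> G" for G xs u
  proof -
    obtain c where "\<And>u. u \<in> G \<Longrightarrow> cone u f xs = c"
      using good[OF G] xs by (auto simp: good_def)
    then show ?thesis using G u by (simp add: S_def faces_def)
  qed
  have "face_orientation G (a G)" if G: "G \<in> faces K (i + 1)" for G
  proof -
    have "S G xs \<noteq> 0" if xs: "xs \<in> orderings G" for xs
    proof -
      obtain u where u: "u \<in> G" using G by (fastforce simp: faces_def)
      then have "\<bar>cone u f xs\<bar> = M" using good[OF G] xs by (auto simp: good_def)
      then show ?thesis using S_eq[OF G xs u] \<open>M > 0\<close> by auto
    qed
    moreover have "alternating_on G (S G)"
      unfolding S_def using cone_alt[OF G] by (rule alternating_on_sum)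
    ultimately have "alternating_on G (a G)"
      unfolding alternating_on_def a_def
      using map_permutes_orderings[of _ G] by (auto simp: sign_def not_less)
    then show ?thesis by (auto simp: face_orientation_def a_def)
  qed
  moreover have "a F (u # ys) = 1 * a G (v # ys)"
    if FG: "F \<in> faces K (i + 1)" "G \<in> faces K (i + 1)" "F \<noteq> G" "F \<inter> G \<in> faces K i" "F - G = {u}" "G - F = {v}"
      and ys: "ys \<in> orderings (F \<inter> G)" for F G u v ys
  proof -
    have "F - {u} = F \<inter> G" "G - {v} = F \<inter> G" "u \<in> F" "v \<in> G" using FG(5,6) by auto
    then have o: "u # ys \<in> orderings F" "v # ys \<in> orderings G"
      using ys by (auto simp: Cons_orderings_iff)
    \<comment> \<open>Both sides are \<open>i + 2\<close> times \<open>f ys\<close>.\<close>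
    have "S F (u # ys) = S G (v # ys)"
      using S_eq[OF FG(1) o(1) \<open>u \<in> F\<close>] S_eq[OF FG(2) o(2) \<open>v \<in> G\<close>] by simp
    then show ?thesis using o by (simp add: a_def)
  qed
  ultimately show ?thesis by (rule coherently_orientableI)
qed

text \<open>By coherence all cofaces of an \<open>i\<close>-face induce the same orientation on it,
  and this orientation is taken as the value of \<open>f\<close>. Every cone of \<open>f\<close> on
  a face \<open>G\<close> then equals \<open>a G\<close>, so all \<open>i + 2\<close> terms of the
  Laplacian agree.\<close>

lemma eigenvalue_of_coherent:
  assumes K: "abstract_complex K" and ne: "faces K (i + 1) \<noteq> {}"
    and coh: "coherently_orientable 1 K i"
  shows "real (i + 2) \<in> normalized_up_spectrum K i"
proof -
  let ?w = "normalized_weight K"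
  have w: "\<forall>F\<in>K. 0 < ?w F" using K by (simp add: normalized_weight_pos)
  obtain a where a: "\<And>F. F \<in> faces K (i + 1) \<Longrightarrow> face_orientation F (a F)"
    and coh: "\<And>F G u v ys. F \<in> faces K (i + 1) \<Longrightarrow> G \<in> faces K (i + 1) \<Longrightarrow> F \<noteq> G \<Longrightarrow>
      F \<inter> G \<in> faces K i \<Longrightarrow> F - G = {u} \<Longrightarrow> G - F = {v} \<Longrightarrow> ys \<in> orderings (F \<inter> G) \<Longrightarrow>
      a F (u # ys) = 1 * a G (v # ys)"
    using coh by (rule coherently_orientableE) blast
  define apex where "apex = (\<lambda>E. SOME v. v \<in> link_vertices K E)"
  \<comment> \<open>An \<open>i\<close>-face without cofaces receives no orientation; the value 0 is
    what the eigenvalue equation requires there.\<close>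
  define f :: "'a list \<Rightarrow> real" where "f = (\<lambda>ys. if ys \<in> \<Union>(orderings ` faces K i) \<and> link_vertices K (set ys) \<noteq> {}
    then of_int (a (insert (apex (set ys)) (set ys)) (apex (set ys) # ys)) else 0)"
  have f_eq: "f ys = of_int (a (insert v E) (v # ys))"
    if E: "E \<in> faces K i" and ys: "ys \<in> orderings E" and v: "v \<in> link_vertices K E" for E ys v
  proof -
    let ?x = "apex E"
    have x: "?x \<in> link_vertices K E" using v unfolding apex_def by (rule someI)
    have [simp]: "set ys = E" using ys by (simp add: orderings_def)
    have "f ys = of_int (a (insert ?x E) (?x # ys))"
      using E ys v by (auto simp: f_def)
    also have "a (insert ?x E) (?x # ys) = 1 * a (insert v E) (v # ys)"
    proof (cases "?x = v")
      case False
      have n: "?x \<notin> E" "v \<notin> E" using x v by (auto simp: link_vertices_def)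
      then have "insert ?x E \<inter> insert v E = E" using False by auto
      then show ?thesis
        using False n E ys
        by (intro coh insert_link_faces[OF E] x v) auto
    qed simp
    finally show ?thesis by simp
  qed
  have fc: "f \<in> cochains K i"
  proof -
    have "alternating_on E f" if E: "E \<in> faces K i" for E
    proof (cases "link_vertices K E = {}")
      case True
      then have "f ys = 0" if "ys \<in> orderings E" for ys
        using that by (auto simp: f_def orderings_def)
      then show ?thesis
        by (subst alternating_on_cong[where g = "\<lambda>_. 0"]) (auto simp: alternating_on_def)
    next
      case False
      then obtain v where v: "v \<in> link_vertices K E" by blast
      then have "insert v E - {v} = E" by (auto simp: link_vertices_def)
      then have "alternating_on E (\<lambda>ys. a (insert v E) (v # ys))"
        using alternating_on_link[OF face_orientation_alternating[OF a[OF insert_link_faces[OF E v]]], of v]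
        by simp
      then have "alternating_on E (\<lambda>ys. real_of_int (a (insert v E) (v # ys)))"
        by (simp add: alternating_on_def)
      then show ?thesis
        by (subst alternating_on_cong[OF f_eq[OF E _ v]])
    qed
    then show ?thesis by (auto simp: cochains_def f_def)
  qed
  have cone_eq: "cone u f xs = of_int (a G xs)"
    if G: "G \<in> faces K (i + 1)" and u: "u \<in> G" and xs: "xs \<in> orderings G" for G u xs
  proof -
    let ?E = "G - {u}"
    have E: "?E \<in> faces K i" using K G u by (rule faces_Diff)
    let ?y = "some_ordering ?E"
    have y: "?y \<in> orderings ?E" by (rule some_ordering_in[OF face_finite[OF E]])
    have "u \<in> link_vertices K ?E" "insert u ?E = G"
      using G u by (auto simp: link_vertices_def faces_def insert_absorb)
    then have "cone u f (u # ?y) = of_int (a G (u # ?y))"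
      using f_eq[OF E y, of u] by simp
    moreover have "alternating_on G (\<lambda>xs. real_of_int (a G xs))"
      using face_orientation_alternating[OF a[OF G]] by (simp add: alternating_on_def)
    moreover have "alternating_on G (cone u f)"
      using cochains_alternating[OF fc E] u by (rule alternating_on_cone)
    moreover have "u # ?y \<in> orderings G" using y u by (simp add: Cons_orderings_iff)
    ultimately show ?thesis using alternating_eqI[OF _ _ _ xs] by blast
  qed
  have "up_laplacian K ?w i f = (\<lambda>xs. real (i + 2) * f xs)"
  proof (rule cochains_ext[OF up_laplacian_cochains[OF K w fc] cochains_scale[OF fc]])
    fix E ys assume E: "E \<in> faces K i" and ys: "ys \<in> orderings E"
    have EK: "E \<in> K" using E by (simp add: faces_def)
    have "?w E * up_laplacian K ?w i f ys = (\<Sum>v\<in>link_vertices K E. ?w (insert v E) * (real (i + 2) * f ys))"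
      unfolding up_laplacian_eq[OF K w fc E ys]
    proof (rule sum.cong[OF refl])
      fix v assume v: "v \<in> link_vertices K E"
      have G: "insert v E \<in> faces K (i + 1)" using E v by (rule insert_link_faces)
      have "cone u f (v # ys) = f ys" if "u \<in> insert v E" for u
        using cone_eq[OF G that, of "v # ys"] f_eq[OF E ys v] ys v
        by (auto simp: link_vertices_def Cons_orderings)
      then have "(\<Sum>u\<in>insert v E. cone u f (v # ys)) = (\<Sum>u\<in>insert v E. f ys)"
        by (rule sum.cong[OF refl])
      then show "?w (insert v E) * (\<Sum>u\<in>insert v E. cone u f (v # ys)) = ?w (insert v E) * (real (i + 2) * f ys)"
        using G by (simp only: sum_constant) (simp add: faces_def)
    qed
    also have "\<dots> = ?w E * (real (i + 2) * f ys)"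
    proof (cases "link_vertices K E = {}")
      case True
      then have "f ys = 0" using ys by (auto simp: f_def orderings_def)
      then show ?thesis by simp
    next
      case False
      then show ?thesis
        unfolding normalized_weight_eq_sum[OF K EK False] sum_distrib_right by simp
    qed
    finally show "up_laplacian K ?w i f ys = real (i + 2) * f ys"
      using w EK by (simp add: less_imp_neq[symmetric])
  qed
  moreover have "f \<noteq> (\<lambda>_. 0)"
  proof -
    obtain G where G: "G \<in> faces K (i + 1)" using ne by blast
    then obtain u where u: "u \<in> G" by (fastforce simp: faces_def)
    have "a G (some_ordering G) \<noteq> 0"
      using face_orientation_values[OF a[OF G] some_ordering_in[OF face_finite[OF G]]] by auto
    then have "cone u f (some_ordering G) \<noteq> 0"
      using cone_eq[OF G u some_ordering_in[OF face_finite[OF G]]] by simp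
    then show ?thesis by (auto simp: cone_def)
  qed
  ultimately show ?thesis
    using fc by (auto simp: normalized_up_spectrum_def)
qed

section \<open>Balanced signed graphs\<close>

text \<open>The sign is constrained to 1 or -1 on edges alone, because \<open>face_sign\<close> is
  arbitrary on pairs that are not adjacent.\<close>

locale signed_graph =
  fixes adj :: "'v \<Rightarrow> 'v \<Rightarrow> bool" and s :: "'v \<Rightarrow> 'v \<Rightarrow> int"
  assumes adj_sym: "adj x y \<Longrightarrow> adj y x"
    and adj_irrefl: "\<not> adj x x"
    and sign_sym: "s x y = s y x"
    and sign_square: "adj x y \<Longrightarrow> s x y * s x y = 1"
begin

fun walk_sign :: "'v list \<Rightarrow> int" where
  "walk_sign (x # y # xs) = s x y * walk_sign (y # xs)"
| "walk_sign _ = 1"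

text \<open>The return to the start is left implicit, so \<open>length c\<close> is the number of
  edges.\<close>

definition closed_walk :: "'v list \<Rightarrow> bool" where
  "closed_walk c \<longleftrightarrow> c \<noteq> [] \<and> successively adj (c @ [hd c])"

definition cycle_sign :: "'v list \<Rightarrow> int" where
  "cycle_sign c = walk_sign (c @ [hd c])"

text \<open>The index condition is the one of \<open>circuit_Suc\<close>, with adjacency in place of
  meeting in an \<open>i\<close>-face.\<close>

definition induced_cycle :: "'v list \<Rightarrow> bool" where
  "induced_cycle c \<longleftrightarrow> distinct c \<and> 3 \<le> length c \<and>
     (\<forall>j<length c. \<forall>l<length c. j \<noteq> l \<longrightarrow>
        (adj (c ! j) (c ! l) \<longleftrightarrow> l = (j + 1) mod length c \<or> j = (l + 1) mod length c))"

text \<open>Reversing the reference orientation where \<open>t\<close> is -1 gives every edge inside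
  \<open>V\<close> the sign \<open>e\<close>: balance for \<open>e = 1\<close>, antibalance for
  \<open>e = -1\<close>.\<close>

definition switching :: "int \<Rightarrow> 'v set \<Rightarrow> ('v \<Rightarrow> int) \<Rightarrow> bool" where
  "switching e V t \<longleftrightarrow> (\<forall>x. t x * t x = 1) \<and> (\<forall>x\<in>V. \<forall>y\<in>V. adj x y \<longrightarrow> t x * t y * s x y = e)"

lemma walk_sign_append:
  "p \<noteq> [] \<Longrightarrow> q \<noteq> [] \<Longrightarrow> walk_sign (p @ q) = walk_sign p * s (last p) (hd q) * walk_sign q"
proof (induction p rule: walk_sign.induct)
  case ("2_2" x)
  then show ?case by (cases q) auto
qed auto

lemma walk_sign_split: "walk_sign (P @ x # Q) = walk_sign (P @ [x]) * walk_sign (x # Q)"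
  by (cases "P = []"; cases "Q = []")
    (auto simp: walk_sign_append[of P "x # Q"] walk_sign_append[of P "[x]"])

lemma walk_sign_rev: "walk_sign (rev p) = walk_sign p"
proof (induction p rule: walk_sign.induct)
  case (1 x y xs)
  then show ?case
    using walk_sign_append[of "rev (y # xs)" "[x]"] sign_sym[of x y] by simp
qed auto

lemma walk_sign_square: "successively adj p \<Longrightarrow> walk_sign p * walk_sign p = 1"
proof (induction p rule: walk_sign.induct)
  case (1 x y xs)
  then have "s x y * s x y = 1" "walk_sign (y # xs) * walk_sign (y # xs) = 1"
    by (auto intro: sign_square)
  then show ?case by (simp add: mult.assoc mult.left_commute[of _ "s x y"])
qed auto

text \<open>The sign of an edge \<open>x\<close>, \<open>y\<close> is \<open>t x * t y * e\<close>,
  and along the walk the inner values of \<open>t\<close> cancel in pairs.\<close>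

lemma walk_sign_switching:
  assumes "switching e V t" "successively adj p" "set p \<subseteq> V" "p \<noteq> []"
  shows "walk_sign p = e ^ (length p - 1) * t (hd p) * t (last p)"
  using assms(2-)
proof (induction p rule: walk_sign.induct)
  case (1 x y xs)
  have xy: "t x * t y * s x y = e" and sq: "t x * t x = 1" "t y * t y = 1"
    using 1 assms(1) by (auto simp: switching_def)
  have "s x y = (t x * t x) * (t y * t y) * s x y" by (simp add: sq)
  also have "\<dots> = t x * t y * e" by (simp only: xy[symmetric] mult_ac)
  finally have "s x y = t x * t y * e" .
  moreover have "walk_sign (y # xs) = e ^ length xs * t y * t (last (y # xs))"
    using 1 by simp
  ultimately have "walk_sign (x # y # xs) = e ^ Suc (length xs) * t x * (t y * t y) * t (last (y # xs))"
    by simp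
  then show ?case by (simp add: sq)
qed (use assms(1) in \<open>auto simp: switching_def\<close>)

lemma cycle_sign_switching:
  assumes "switching e V t" "closed_walk c" "set c \<subseteq> V"
  shows "cycle_sign c = e ^ length c"
proof -
  have "t (hd c) * t (hd c) = 1" using assms(1) by (simp add: switching_def)
  then show ?thesis
    unfolding cycle_sign_def using assms
    by (subst walk_sign_switching) (auto simp: closed_walk_def mult.assoc)
qed

lemma cycle_sign_square: "closed_walk c \<Longrightarrow> cycle_sign c * cycle_sign c = 1"
  by (simp add: closed_walk_def cycle_sign_def walk_sign_square)

lemma induced_cycle_closed_walk:
  assumes "induced_cycle c"
  shows "closed_walk c"
proof -
  let ?m = "length c"
  have m: "3 \<le> ?m" using assms by (simp add: induced_cycle_def)
  have hd: "hd c = c ! 0" using m by (intro hd_conv_nth) auto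
  have "adj ((c @ [hd c]) ! k) ((c @ [hd c]) ! Suc k)" if "k < ?m" for k
  proof -
    define l where "l = Suc k mod ?m"
    have l: "l < ?m" "l \<noteq> k" using m that
      by (auto simp: l_def mod_Suc)
    then have "adj (c ! k) (c ! l)"
      using assms that by (auto simp: induced_cycle_def l_def)
    moreover have "(c @ [hd c]) ! Suc k = c ! l"
      using that hd by (auto simp: nth_append l_def mod_Suc)
    ultimately show ?thesis using that by (simp add: nth_append)
  qed
  then show ?thesis
    using m by (auto simp: closed_walk_def successively_conv_nth)
qed

text \<open>A repeated vertex or a chord cuts the walk into two shorter closed walks. A chord is
  traversed once in each of them, so its sign cancels and the two signs multiply to the sign of
  \<open>c\<close>; they cannot both be 1.\<close>

lemma shortest_negative_closed_walk_induced:
  assumes c: "closed_walk c" "cycle_sign c \<noteq> 1"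
    and min: "\<And>d. closed_walk d \<Longrightarrow> length d < length c \<Longrightarrow> cycle_sign d = 1"
  shows "induced_cycle c"
proof -
  let ?m = "length c"
  have ne: "c \<noteq> []" using c by (simp add: closed_walk_def)
  have adjs: "adj ((c @ [hd c]) ! k) ((c @ [hd c]) ! Suc k)" if "k < ?m" for k
    using c(1) that unfolding closed_walk_def successively_conv_nth by simp
  have repeat: False if "c = A @ x # B @ x # C" for A B C x
  proof -
    \<comment> \<open>The first vertex of the walk, which is \<open>x\<close> itself if
      \<open>A\<close> is empty.\<close>
    let ?h = "hd (A @ [x])"
    have h: "hd c = ?h" "hd (A @ x # C) = ?h" using that by (cases A; simp)+
    have w: "successively adj (A @ x # B @ x # C @ [?h])"
      using c(1) h that by (simp add: closed_walk_def)
    have "closed_walk (x # B)" "closed_walk (A @ x # C)"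
      using w h by (auto simp: closed_walk_def successively_append_iff successively_Cons hd_append split: if_splits)
    then have "cycle_sign (x # B) = 1" "cycle_sign (A @ x # C) = 1"
      using min that by auto
    moreover have "cycle_sign c = cycle_sign (x # B) * cycle_sign (A @ x # C)"
    proof -
      show ?thesis
        unfolding cycle_sign_def h using walk_sign_split[of A x "B @ x # C @ [?h]"]
          walk_sign_split[of "x # B" x "C @ [?h]"] walk_sign_split[of A x "C @ [?h]"] that by simp
    qed
    ultimately show False using c(2) by simp
  qed
  have "distinct c"
    using repeat not_distinct_decomp[of c] by fastforce
  \<comment> \<open>In the two alternatives the edge is a step of the walk or its closing edge.
    Excluding them is precisely what makes both pieces shorter than \<open>c\<close>.\<close>
  have chord: "B = [] \<or> A = [] \<and> C = []" if "c = A @ x # B @ y # C" "adj x y" for A B C x y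
  proof (rule ccontr)
    assume n: "\<not> ?thesis"
    let ?h = "hd (A @ [x])"
    have h: "hd c = ?h" "hd (A @ x # y # C) = ?h" using that by (cases A; simp)+
    have w: "successively adj (A @ x # B @ y # C @ [?h])"
      using c(1) h that by (simp add: closed_walk_def)
    have "closed_walk (x # B @ [y])" "closed_walk (A @ x # y # C)"
      using w h that(2) adj_sym[OF that(2)]
      by (auto simp: closed_walk_def successively_append_iff successively_Cons hd_append split: if_splits)
    then have "cycle_sign (x # B @ [y]) = 1" "cycle_sign (A @ x # y # C) = 1"
      using min that n by auto
    moreover have "cycle_sign c = cycle_sign (x # B @ [y]) * cycle_sign (A @ x # y # C)"
    proof -
      have "cycle_sign c = walk_sign (A @ [x]) * walk_sign (x # B @ [y]) * walk_sign (y # C @ [?h])"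
        unfolding cycle_sign_def h using walk_sign_split[of A x "B @ y # C @ [?h]"]
          walk_sign_split[of "x # B" y "C @ [?h]"]
          that by simp
      \<comment> \<open>The sign of the chord is inserted twice, one copy for each piece.\<close>
      also have "\<dots> = walk_sign (x # B @ [y]) * (s x y * s x y) * (walk_sign (A @ [x]) * walk_sign (y # C @ [?h]))"
        by (simp add: sign_square[OF that(2)])
      also have "\<dots> = (walk_sign (x # B @ [y]) * s y x) * (walk_sign (A @ [x]) * s x y * walk_sign (y # C @ [?h]))"
        by (simp only: sign_sym[of y x] mult_ac)
      also have "walk_sign (x # B @ [y]) * s y x = cycle_sign (x # B @ [y])"
        unfolding cycle_sign_def using walk_sign_append[of "x # B @ [y]" "[x]"] by simp
      also have "walk_sign (A @ [x]) * s x y * walk_sign (y # C @ [?h]) = cycle_sign (A @ x # y # C)"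
        unfolding cycle_sign_def h(2) using walk_sign_split[of A x "y # C @ [?h]"] by simp
      finally show ?thesis .
    qed
    ultimately show False using c(2) by simp
  qed
  \<comment> \<open>One vertex would need a loop; two vertices traverse one edge back and forth,
    with sign 1.\<close>
  have "3 \<le> ?m"
  proof (rule ccontr)
    assume "\<not> 3 \<le> ?m"
    then have "?m = 1 \<or> ?m = 2" using ne by (cases "?m") auto
    then show False
    proof
      assume "?m = 1"
      then obtain x where "c = [x]" by (auto simp: length_Suc_conv)
      then show False using c(1) adj_irrefl by (simp add: closed_walk_def)
    next
      assume "?m = 2"
      then obtain x y where "c = [x, y]" by (auto simp: length_Suc_conv numeral_2_eq_2)
      then show False
        using c sign_square[of x y] sign_sym[of x y] by (simp add: closed_walk_def cycle_sign_def)
    qed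
  qed
  have next_adj: "adj (c ! k) (c ! (Suc k mod ?m))" if "k < ?m" for k
    using adjs[OF that] that ne by (auto simp: nth_append mod_Suc hd_conv_nth)
  have lt: "l = Suc j \<or> j = 0 \<and> Suc l = ?m" if "j < l" "l < ?m" "adj (c ! j) (c ! l)" for j l
  proof -
    let ?B = "take (l - Suc j) (drop (Suc j) c)"
    have "c = take j c @ c ! j # drop (Suc j) c"
      using that by (simp add: id_take_nth_drop)
    moreover have "drop (Suc j) c = ?B @ c ! l # drop (Suc l) c"
      using that id_take_nth_drop[of "l - Suc j" "drop (Suc j) c"] by simp
    ultimately have "c = take j c @ c ! j # ?B @ c ! l # drop (Suc l) c" by simp
    from chord[OF this that(3)] show ?thesis using that by auto
  qed
  have "adj (c ! j) (c ! l) \<longleftrightarrow> l = (j + 1) mod ?m \<or> j = (l + 1) mod ?m"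
    if jl: "j < ?m" "l < ?m" "j \<noteq> l" for j l
  proof
    assume a: "adj (c ! j) (c ! l)"
    consider "j < l" | "l < j" using jl by linarith
    then show "l = (j + 1) mod ?m \<or> j = (l + 1) mod ?m"
    proof cases
      case 1
      then show ?thesis using lt[OF 1 jl(2) a] jl by auto
    next
      case 2
      then show ?thesis using lt[OF 2 jl(1) adj_sym[OF a]] jl by auto
    qed
  next
    assume "l = (j + 1) mod ?m \<or> j = (l + 1) mod ?m"
    then show "adj (c ! j) (c ! l)"
      using next_adj[OF jl(1)] next_adj[OF jl(2)] adj_sym by auto
  qed
  then show ?thesis
    using \<open>distinct c\<close> \<open>3 \<le> ?m\<close> by (simp add: induced_cycle_def)
qed

lemma closed_walk_positive:
  assumes "\<And>d. induced_cycle d \<Longrightarrow> cycle_sign d = 1" "closed_walk c"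
  shows "cycle_sign c = 1"
  using assms(2)
proof (induction c rule: length_induct)
  case (1 c)
  show ?case
  proof (rule ccontr)
    assume "cycle_sign c \<noteq> 1"
    with 1 have "induced_cycle c"
      by (intro shortest_negative_closed_walk_induced) auto
    then show False using assms(1) \<open>cycle_sign c \<noteq> 1\<close> by blast
  qed
qed

lemma ex_walk:
  assumes "(x, y) \<in> {(a, b). adj a b}\<^sup>*"
  shows "\<exists>p. successively adj p \<and> p \<noteq> [] \<and> hd p = x \<and> last p = y"
  using assms
proof (induction rule: rtrancl_induct)
  case base
  show ?case by (rule exI[of _ "[x]"]) simp
next
  case (step y z)
  then obtain p where "successively adj p" "p \<noteq> []" "hd p = x" "last p = y" by blast
  then show ?case
    using step.hyps(2) by (intro exI[of _ "p @ [z]"]) (auto simp: successively_append_iff)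
qed

text \<open>Take for \<open>t x\<close> the sign of a walk from the root \<open>r\<close> to
  \<open>x\<close>. For an edge from \<open>x\<close> to \<open>y\<close>, going out to
  \<open>x\<close>, across the edge and back from \<open>y\<close> is a closed walk, and its
  positivity is the required equation.\<close>

lemma ex_switching:
  assumes pos: "\<And>c. closed_walk c \<Longrightarrow> cycle_sign c = 1"
    and conn: "\<And>x. x \<in> V \<Longrightarrow> (r, x) \<in> {(a, b). adj a b}\<^sup>*"
  shows "\<exists>t. switching 1 V t"
proof -
  define p where "p = (\<lambda>x. SOME p. successively adj p \<and> p \<noteq> [] \<and> hd p = r \<and> last p = x)"
  have p: "successively adj (p x)" "p x \<noteq> []" "hd (p x) = r" "last (p x) = x" if "x \<in> V" for x
    using someI_ex[OF ex_walk[OF conn[OF that]]] unfolding p_def by auto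
  define t where "t = (\<lambda>x. if x \<in> V then walk_sign (p x) else 1)"
  have "t x * t y * s x y = 1" if x: "x \<in> V" and y: "y \<in> V" and a: "adj x y" for x y
  proof -
    have "p y = r # tl (p y)" using p(2,3)[OF y] by (metis list.collapse)
    then have "rev (p y) = rev (tl (p y)) @ [r]" by (metis rev.simps(2))
    \<comment> \<open>The root at the end of the way back is dropped, since a closed walk returns to
      its start implicitly.\<close>
    then have eq: "(p x @ rev (tl (p y))) @ [hd (p x @ rev (tl (p y)))] = p x @ rev (p y)"
      using p[OF x] by simp
    have "successively adj (rev (p y))"
    proof -
      have "successively (\<lambda>x y. adj y x) (p y)"
        using p(1)[OF y] by (rule successively_mono) (rule adj_sym)
      then show ?thesis by (simp add: successively_rev)
    qed
    then have "successively adj (p x @ rev (p y))"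
      using p[OF x] p[OF y] a by (simp add: successively_append_iff hd_rev)
    then have "closed_walk (p x @ rev (tl (p y)))"
      unfolding closed_walk_def eq using p(2)[OF x] by simp
    from pos[OF this] have "walk_sign (p x @ rev (p y)) = 1"
      unfolding cycle_sign_def eq .
    then show ?thesis
      using walk_sign_append[of "p x" "rev (p y)"] p[OF x] p[OF y] x y
      by (simp add: hd_rev walk_sign_rev t_def mult_ac)
  qed
  moreover have "t x * t x = 1" for x
    using p(1) by (simp add: t_def walk_sign_square)
  ultimately show ?thesis unfolding switching_def by blast
qed

text \<open>Without chords, the edges inside \<open>set c\<close> are those of the cycle. The signs
  can be prescribed one vertex after the other, and the closing edge imposes the single
  condition.\<close>

lemma switching_induced_cycle_iff:
  assumes c: "induced_cycle c" and e: "e * e = 1"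
  shows "(\<exists>t. switching e (set c) t) \<longleftrightarrow> cycle_sign c = e ^ length c"
proof
  assume "\<exists>t. switching e (set c) t"
  then show "cycle_sign c = e ^ length c"
    using cycle_sign_switching induced_cycle_closed_walk[OF c] by blast
next
  assume sgn: "cycle_sign c = e ^ length c"
  let ?m = "length c"
  have d: "distinct c" and m: "3 \<le> ?m" using c by (auto simp: induced_cycle_def)
  have w: "successively adj c"
    using induced_cycle_closed_walk[OF c] by (auto simp: closed_walk_def successively_append_iff)
  define idx where "idx = (\<lambda>x. THE k. k < ?m \<and> c ! k = x)"
  have idx: "idx (c ! k) = k" if "k < ?m" for k
    unfolding idx_def using d that by (auto simp: nth_eq_iff_index_eq)
  \<comment> \<open>Solving the equations along the path with value 1 at the first vertex forces
    this formula.\<close>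
  define t where "t = (\<lambda>x. if x \<in> set c then e ^ idx x * walk_sign (take (Suc (idx x)) c) else 1)"
  have t: "t (c ! k) = e ^ k * walk_sign (take (Suc k) c)" if "k < ?m" for k
    using that by (simp add: t_def idx)
  have ee: "e ^ k * e ^ k = 1" for k
    by (metis e power_mult_distrib power_one)
  have ww: "walk_sign (take k c) * walk_sign (take k c) = 1" for k
    by (rule walk_sign_square) (metis w append_take_drop_id successively_append_iff)
  have tt: "t x * t x = 1" for x
  proof -
    let ?j = "idx x" and ?b = "walk_sign (take (Suc (idx x)) c)"
    have "(e ^ ?j * ?b) * (e ^ ?j * ?b) = (e ^ ?j * e ^ ?j) * (?b * ?b)"
      by (simp only: mult_ac)
    then show ?thesis unfolding t_def by (simp only: ee ww mult_1 split: if_split) simp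
  qed
  have nxt: "t (c ! k) * t (c ! (Suc k mod ?m)) * s (c ! k) (c ! (Suc k mod ?m)) = e" if k: "k < ?m" for k
  proof (cases "Suc k < ?m")
    case True
    let ?a = "walk_sign (take (Suc k) c)" and ?s = "s (c ! k) (c ! Suc k)"
    have "adj (c ! k) (c ! Suc k)" using w True by (simp add: successively_conv_nth)
    then have ss: "?s * ?s = 1" by (rule sign_square)
    have "last (take (Suc k) c) = c ! k" using k by (simp add: take_Suc_conv_app_nth)
    then have "walk_sign (take (Suc (Suc k)) c) = ?a * ?s"
      using walk_sign_append[of "take (Suc k) c" "[c ! Suc k]"] True
      by (cases "c = []") (auto simp: take_Suc_conv_app_nth[OF True])
    then have "t (c ! k) * t (c ! Suc k) * ?s = (e ^ k * e ^ k) * e * (?a * ?a) * (?s * ?s)"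
      using True k by (simp only: t) (simp only: power_Suc mult_ac)
    then show ?thesis using True by (simp add: ee ww ss)
  next
    case False
    then have Sk: "Suc k = ?m" using k by simp
    have "c \<noteq> []" using m by auto
    then have "last c = c ! k" by (simp add: last_conv_nth Sk[symmetric])
    moreover have "hd c = c ! 0" using m by (intro hd_conv_nth) auto
    \<comment> \<open>The closing edge is where the assumption on the cycle sign enters.\<close>
    ultimately have "walk_sign c * s (c ! k) (c ! 0) = e ^ Suc k"
      using sgn Sk walk_sign_append[of c "[hd c]"] m unfolding cycle_sign_def by fastforce
    moreover have "t (c ! k) = e ^ k * walk_sign c" using t[OF k] Sk by simp
    moreover have "t (c ! 0) = 1" using t[of 0] m by (cases c) auto
    ultimately have "t (c ! k) * t (c ! 0) * s (c ! k) (c ! 0) = e ^ k * e ^ Suc k"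
      by (simp add: mult.assoc)
    also have "\<dots> = e" using ee[of k] by (simp add: mult.left_commute)
    finally show ?thesis using Sk by simp
  qed
  have "t x * t y * s x y = e" if xy: "x \<in> set c" "y \<in> set c" "adj x y" for x y
  proof -
    obtain j l where jl: "j < ?m" "l < ?m" "x = c ! j" "y = c ! l"
      using xy by (metis in_set_conv_nth)
    moreover have "j \<noteq> l" using xy(3) jl adj_irrefl by auto
    ultimately have "l = Suc j mod ?m \<or> j = Suc l mod ?m"
      using c xy(3) by (auto simp: induced_cycle_def)
    then show ?thesis
      using nxt[OF jl(1)] nxt[OF jl(2)] jl sign_sym[of x y] by (auto simp: mult_ac)
  qed
  then show "\<exists>t. switching e (set c) t" using tt unfolding switching_def by blast
qed

end

section \<open>The adjacency graph of the faces\<close>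

definition face_adj :: "'a set set \<Rightarrow> nat \<Rightarrow> 'a set \<Rightarrow> 'a set \<Rightarrow> bool" where
  "face_adj K i F G \<longleftrightarrow> F \<in> faces K (i + 1) \<and> G \<in> faces K (i + 1) \<and> F \<noteq> G \<and> F \<inter> G \<in> faces K i"

text \<open>Relative to a fixed reference an orientation of a face is a single sign, so choosing
  orientations becomes choosing a switching function.\<close>

definition ref_orientation :: "'a set \<Rightarrow> 'a list \<Rightarrow> int" where
  "ref_orientation F = (SOME a. face_orientation F a)"

text \<open>
  For adjacent faces this is 1 if the reference orientations of \<open>F\<close> and \<open>G\<close> induce the same
  orientation on the common face \<open>F \<inter> G\<close>, and -1 otherwise.
\<close>

definition face_sign :: "'a set \<Rightarrow> 'a set \<Rightarrow> int" where
  "face_sign F G =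
     ref_orientation F ((SOME u. u \<in> F - G) # some_ordering (F \<inter> G)) *
     ref_orientation G ((SOME v. v \<in> G - F) # some_ordering (F \<inter> G))"

lemma ref_orientation: "finite F \<Longrightarrow> face_orientation F (ref_orientation F)"
  unfolding ref_orientation_def by (rule someI_ex[OF ex_face_orientation])

lemma face_orientation_square:
  "face_orientation F a \<Longrightarrow> xs \<in> orderings F \<Longrightarrow> a xs * a xs = 1"
  using face_orientation_values[of F a xs] by auto

lemma face_adj_Diff:
  assumes "face_adj K i F G"
  obtains u v where "F - G = {u}" "G - F = {v}" "F - {u} = F \<inter> G" "G - {v} = F \<inter> G" "u \<in> F" "v \<in> G"
proof -
  have c: "card F = i + 2" "card G = i + 2" "card (F \<inter> G) = i + 1"
    using assms by (auto simp: face_adj_def faces_def)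
  then have "finite F" "finite G" by (auto intro: card_ge_0_finite)
  then have "card (F - G) = 1" "card (G - F) = 1"
    using c card_Diff_subset_Int[of F G] card_Diff_subset_Int[of G F] by (auto simp: Int_commute)
  then obtain u v where "F - G = {u}" "G - F = {v}" by (auto simp: card_1_singleton_iff)
  then show ?thesis by (intro that[of u v]) auto
qed

text \<open>Reordering the common face changes both factors by the same sign.\<close>

lemma face_sign_eq:
  assumes FG: "face_adj K i F G" and uv: "F - G = {u}" "G - F = {v}" and ys: "ys \<in> orderings (F \<inter> G)"
  shows "face_sign F G = ref_orientation F (u # ys) * ref_orientation G (v # ys)"
proof -
  have fin: "finite F" "finite G" using FG face_finite by (auto simp: face_adj_def)
  have D: "F - {u} = F \<inter> G" "G - {v} = F \<inter> G" "u \<in> F" "v \<in> G" using uv by auto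
  have "alternating_on (F \<inter> G) (\<lambda>ys. ref_orientation F (u # ys))"
    using alternating_on_link[OF face_orientation_alternating[OF ref_orientation[OF fin(1)]] D(3)] D(1) by simp
  moreover have "alternating_on (F \<inter> G) (\<lambda>ys. ref_orientation G (v # ys))"
    using alternating_on_link[OF face_orientation_alternating[OF ref_orientation[OF fin(2)]] D(4)] D(2) by simp
  ultimately show ?thesis
    using alternating_prod_eq[OF _ _ ys some_ordering_in[of "F \<inter> G"]] fin
    unfolding face_sign_def uv by simp
qed

lemma signed_graph_faces: "signed_graph (face_adj K i) face_sign"
proof
  fix F G :: "'a set"
  show "face_adj K i F G \<Longrightarrow> face_adj K i G F" by (auto simp: face_adj_def Int_commute)
  show "\<not> face_adj K i F F" by (simp add: face_adj_def)
  show "face_sign F G = face_sign G F" by (simp add: face_sign_def Int_commute mult.commute)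
  assume FG: "face_adj K i F G"
  then obtain u v where uv: "F - G = {u}" "G - F = {v}" and
    D: "F - {u} = F \<inter> G" "G - {v} = F \<inter> G" "u \<in> F" "v \<in> G" by (rule face_adj_Diff)
  have fin: "finite F" "finite G" using FG face_finite by (auto simp: face_adj_def)
  let ?y = "some_ordering (F \<inter> G)"
  have y: "?y \<in> orderings (F \<inter> G)" using fin by (simp add: some_ordering_in)
  have "ref_orientation F (u # ?y) * ref_orientation F (u # ?y) = 1"
    "ref_orientation G (v # ?y) * ref_orientation G (v # ?y) = 1"
    by (rule face_orientation_square[OF ref_orientation[OF fin(1)]],
        use y D in \<open>simp add: Cons_orderings_iff\<close>)
       (rule face_orientation_square[OF ref_orientation[OF fin(2)]],
        use y D in \<open>simp add: Cons_orderings_iff\<close>)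
  then show "face_sign F G * face_sign F G = 1"
    unfolding face_sign_eq[OF FG uv y] mult.assoc
    by (simp only: mult.left_commute[of "ref_orientation G (v # ?y)" "ref_orientation F (u # ?y)"] mult_1_right)
qed

text \<open>Orientations \<open>a\<close> and signs \<open>t\<close> determine each other by
  \<open>a F = t F * ref_orientation F\<close> on orderings of \<open>F\<close>. The graph of the
  larger complex \<open>K\<close> serves for every subcomplex \<open>L\<close>, since the
  intersection of two faces of \<open>L\<close> lies in \<open>L\<close> and adjacency is the same
  in both.\<close>

lemma coherently_orientable_iff_switching:
  fixes K :: "'a set set"
  assumes "L \<subseteq> K" "abstract_complex L"
  shows "coherently_orientable e L i \<longleftrightarrow>
    (\<exists>t. signed_graph.switching (face_adj K i) face_sign e (faces L (i + 1)) t)"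
proof -
  interpret signed_graph "face_adj K i" face_sign by (rule signed_graph_faces)
  have adj: "F \<noteq> G \<and> F \<inter> G \<in> faces L i \<longleftrightarrow> face_adj K i F G"
    if "F \<in> faces L (i + 1)" "G \<in> faces L (i + 1)" for F G
    using that assms abstract_complexD(3)[OF assms(2), of F "F \<inter> G"] by (auto simp: face_adj_def faces_def)
  have so: "some_ordering F \<in> orderings F" if "F \<in> faces L (i + 1)" for F
    using some_ordering_in[OF face_finite[OF that]] .
  show ?thesis
  proof
    assume "coherently_orientable e L i"
    then obtain a where a: "\<And>F. F \<in> faces L (i + 1) \<Longrightarrow> face_orientation F (a F)"
      and coh: "\<And>F G u v ys. F \<in> faces L (i + 1) \<Longrightarrow> G \<in> faces L (i + 1) \<Longrightarrow> F \<noteq> G \<Longrightarrow>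
        F \<inter> G \<in> faces L i \<Longrightarrow> F - G = {u} \<Longrightarrow> G - F = {v} \<Longrightarrow> ys \<in> orderings (F \<inter> G) \<Longrightarrow>
        a F (u # ys) = e * a G (v # ys)"
      by (rule coherently_orientableE) blast
    define t where "t = (\<lambda>F. if F \<in> faces L (i + 1)
      then a F (some_ordering F) * ref_orientation F (some_ordering F) else 1)"
    have t: "t F = a F xs * ref_orientation F xs" if F: "F \<in> faces L (i + 1)" and "xs \<in> orderings F" for F xs
      using alternating_prod_eq[OF face_orientation_alternating[OF a[OF F]]
          face_orientation_alternating[OF ref_orientation[OF face_finite[OF F]]] \<open>xs \<in> orderings F\<close> so[OF F]] F
      by (simp add: t_def)
    have "t F * t F = 1" for F
    proof (cases "F \<in> faces L (i + 1)")
      case True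
      then show ?thesis
        using face_orientation_values[OF a[OF True] so[OF True]]
          face_orientation_values[OF ref_orientation[OF face_finite[OF True]] so[OF True]]
        by (auto simp: t_def)
    qed (simp add: t_def)
    moreover have "t F * t G * face_sign F G = e"
      if F: "F \<in> faces L (i + 1)" and G: "G \<in> faces L (i + 1)" and FG: "face_adj K i F G" for F G
    proof -
      obtain u v where uv: "F - G = {u}" "G - F = {v}" and
        D: "F - {u} = F \<inter> G" "G - {v} = F \<inter> G" "u \<in> F" "v \<in> G" using FG by (rule face_adj_Diff)
      let ?y = "some_ordering (F \<inter> G)"
      have y: "?y \<in> orderings (F \<inter> G)" using face_finite[OF F] by (simp add: some_ordering_in)
      then have o: "u # ?y \<in> orderings F" "v # ?y \<in> orderings G" using D by (auto simp: Cons_orderings_iff)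
      let ?a = "a F (u # ?y)" and ?b = "a G (v # ?y)"
        and ?r = "ref_orientation F (u # ?y)" and ?q = "ref_orientation G (v # ?y)"
      have "t F * t G * face_sign F G = ?a * ?b * (?r * ?r) * (?q * ?q)"
        unfolding t[OF F o(1)] t[OF G o(2)] face_sign_eq[OF FG uv y] by (simp only: mult_ac)
      also have "\<dots> = ?a * ?b"
        using face_orientation_square[OF ref_orientation[OF face_finite[OF F]] o(1)]
          face_orientation_square[OF ref_orientation[OF face_finite[OF G]] o(2)] by simp
      also have "?a = e * ?b"
        using coh[OF F G _ _ uv y] adj[OF F G] FG by blast
      finally show ?thesis
        using face_orientation_square[OF a[OF G] o(2)] by (simp add: mult.assoc)
    qed
    ultimately show "\<exists>t. switching e (faces L (i + 1)) t" unfolding switching_def by blast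
  next
    assume "\<exists>t. switching e (faces L (i + 1)) t"
    then obtain t where t: "\<And>F. t F * t F = 1" "\<And>F G. F \<in> faces L (i + 1) \<Longrightarrow> G \<in> faces L (i + 1) \<Longrightarrow>
        face_adj K i F G \<Longrightarrow> t F * t G * face_sign F G = e"
      unfolding switching_def by blast
    have t1: "t F = 1 \<or> t F = -1" for F
      using t(1)[of F] by (simp add: zmult_eq_1_iff)
    define a where "a = (\<lambda>F xs. t F * ref_orientation F xs)"
    have "face_orientation F (a F)" if F: "F \<in> faces L (i + 1)" for F
      using ref_orientation[OF face_finite[OF F]] t1[of F]
      by (auto simp: face_orientation_def a_def alternating_on_scale)
    moreover have "a F (u # ys) = e * a G (v # ys)"
      if F: "F \<in> faces L (i + 1)" and G: "G \<in> faces L (i + 1)" and ne: "F \<noteq> G" "F \<inter> G \<in> faces L i"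
        and uv: "F - G = {u}" "G - F = {v}" and ys: "ys \<in> orderings (F \<inter> G)" for F G u v ys
    proof -
      have FG: "face_adj K i F G" using adj[OF F G] ne by blast
      have "v # ys \<in> orderings G"
      proof -
        have "G - {v} = F \<inter> G" "v \<in> G" using uv by auto
        then show ?thesis using ys by (simp add: Cons_orderings_iff)
      qed
      then have q: "ref_orientation G (v # ys) * ref_orientation G (v # ys) = 1"
        by (rule face_orientation_square[OF ref_orientation[OF face_finite[OF G]]])
      have "e * a G (v # ys) = t F * ref_orientation F (u # ys) * (t G * t G)
          * (ref_orientation G (v # ys) * ref_orientation G (v # ys))"
        unfolding t(2)[OF F G FG, symmetric] face_sign_eq[OF FG uv ys] a_def by (simp only: mult_ac)
      then show ?thesis by (simp add: q t(1) a_def)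
    qed
    ultimately show "coherently_orientable e L i" by (rule coherently_orientableI)
  qed
qed

section \<open>Circuits and induced cycles of the adjacency graph\<close>

lemma circuit_Suc_induced_cycle:
  assumes "circuit_Suc K i m L"
  obtains c where "signed_graph.induced_cycle (face_adj K i) c" "set c = faces L (i + 1)" "length c = m"
proof -
  interpret signed_graph "face_adj K i" face_sign by (rule signed_graph_faces)
  obtain Fs where Fs: "distinct Fs" "length Fs = m" "set Fs = faces L (i + 1)" and
    cyc: "\<And>j l. j < m \<Longrightarrow> l < m \<Longrightarrow> j \<noteq> l \<Longrightarrow>
      Fs ! j \<inter> Fs ! l \<in> faces L i \<longleftrightarrow> l = (j + 1) mod m \<or> j = (l + 1) mod m"
    and L: "3 \<le> m" "L \<subseteq> K" "abstract_complex L"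
    using assms unfolding circuit_Suc_def pure_complex_def by blast
  have "face_adj K i (Fs ! j) (Fs ! l) \<longleftrightarrow> l = (j + 1) mod m \<or> j = (l + 1) mod m"
    if jl: "j < m" "l < m" "j \<noteq> l" for j l
  proof -
    have "Fs ! j \<noteq> Fs ! l" using jl Fs by (simp add: nth_eq_iff_index_eq)
    moreover have "Fs ! j \<in> faces L (i + 1)" "Fs ! l \<in> faces L (i + 1)"
      using jl Fs nth_mem by blast+
    moreover have "Fs ! j \<inter> Fs ! l \<in> L"
      using calculation abstract_complexD(3)[OF L(3), of "Fs ! j"] by (auto simp: faces_def)
    ultimately show ?thesis
      unfolding cyc[OF jl, symmetric] using L(2) by (auto simp: face_adj_def faces_def)
  qed
  then have "induced_cycle Fs" using Fs L(1) by (simp add: induced_cycle_def)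
  then show ?thesis using Fs that by blast
qed

lemma induced_cycle_circuit_Suc:
  assumes K: "abstract_complex K" and c: "signed_graph.induced_cycle (face_adj K i) c"
  obtains L where "circuit_Suc K i (length c) L" "faces L (i + 1) = set c"
proof -
  interpret signed_graph "face_adj K i" face_sign by (rule signed_graph_faces)
  let ?m = "length c"
  have d: "distinct c" "3 \<le> ?m" and
    cyc: "\<And>j l. j < ?m \<Longrightarrow> l < ?m \<Longrightarrow> j \<noteq> l \<Longrightarrow>
      face_adj K i (c ! j) (c ! l) \<longleftrightarrow> l = (j + 1) mod ?m \<or> j = (l + 1) mod ?m"
    using c by (auto simp: induced_cycle_def)
  \<comment> \<open>\<open>induced_cycle\<close> does not say that its entries are faces; each of
    them is one because it has a neighbour.\<close>
  have cK: "F \<in> faces K (i + 1)" if "F \<in> set c" for F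
  proof -
    obtain j where j: "j < ?m" "F = c ! j" using \<open>F \<in> set c\<close> by (metis in_set_conv_nth)
    moreover have "(j + 1) mod ?m < ?m" "j \<noteq> (j + 1) mod ?m" using j d(2) by (auto simp: mod_Suc)
    ultimately have "face_adj K i F (c ! ((j + 1) mod ?m))" using cyc by blast
    then show ?thesis by (simp add: face_adj_def)
  qed
  \<comment> \<open>The subcomplex generated by the faces on the cycle. Comparing cardinalities
    shows that it has no further \<open>(i+1)\<close>-faces.\<close>
  define L where "L = (\<Union>F\<in>set c. Pow F)"
  have L: "L \<subseteq> K"
    using cK abstract_complexD(3)[OF K] by (auto simp: L_def faces_def)
  have faces: "faces L (i + 1) = set c"
  proof (intro equalityI subsetI)
    fix F assume "F \<in> faces L (i + 1)"
    then obtain G where G: "G \<in> set c" "F \<subseteq> G" "card F = i + 2" by (auto simp: faces_def L_def)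
    then have "F = G"
      using cK[OF G(1)] face_finite[OF cK[OF G(1)]] by (intro card_subset_eq) (auto simp: faces_def)
    then show "F \<in> set c" using G by simp
  next
    fix F assume "F \<in> set c"
    then show "F \<in> faces L (i + 1)" using cK[of F] by (auto simp: faces_def L_def)
  qed
  have "c \<noteq> []" using d by auto
  then have "{} \<in> L" using hd_in_set[of c] by (auto simp: L_def simp del: hd_in_set)
  moreover have "G \<in> L" if "F \<in> L" "G \<subseteq> F" for F G using that by (auto simp: L_def)
  ultimately have aL: "abstract_complex L"
    using L finite_subset[OF L] abstract_complexD(1,2)[OF K] unfolding abstract_complex_def by blast
  have "pure_complex L (i + 1)"
    unfolding pure_complex_def
  proof (intro conjI aL allI impI)
    fix F assume F: "is_facet L F"
    then obtain G where G: "G \<in> set c" "F \<subseteq> G" by (auto simp: is_facet_def L_def)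
    then have "G \<in> L" by (auto simp: L_def)
    then have "F = G" using F G by (auto simp: is_facet_def)
    then show "F \<in> faces L (i + 1)" using G faces by simp
  qed
  moreover have "c ! j \<inter> c ! l \<in> faces L i \<longleftrightarrow> l = (j + 1) mod ?m \<or> j = (l + 1) mod ?m"
    if jl: "j < ?m" "l < ?m" "j \<noteq> l" for j l
  proof -
    have "c ! j \<noteq> c ! l" using jl d by (simp add: nth_eq_iff_index_eq)
    moreover have "c ! j \<in> set c" "c ! l \<in> set c" using jl by auto
    moreover have "c ! j \<inter> c ! l \<in> L"
      using calculation by (auto simp: L_def)
    ultimately show ?thesis
      unfolding cyc[OF jl, symmetric] using L cK by (auto simp: face_adj_def faces_def)
  qed
  ultimately have "circuit_Suc K i ?m L"
    unfolding circuit_Suc_def using d L faces by blast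
  then show ?thesis using faces that by blast
qed

text \<open>Two distinct faces with \<open>i + 2\<close> vertices meet in at most
  \<open>i + 1\<close> of them, so a shared \<open>i\<close>-face is their whole intersection. Steps
  that stay at one face are absorbed by reflexivity.\<close>

lemma path_connected_face_adj:
  assumes "path_connected_Suc K i" "F \<in> faces K (i + 1)" "G \<in> faces K (i + 1)"
    and K: "abstract_complex K"
  shows "(F, G) \<in> {(A, B). face_adj K i A B}\<^sup>*"
proof -
  let ?R = "{(A, B). A \<in> faces K (i + 1) \<and> B \<in> faces K (i + 1) \<and> (\<exists>E\<in>faces K i. E \<subseteq> A \<and> E \<subseteq> B)}"
  have "?R \<subseteq> {(A, B). face_adj K i A B}\<^sup>*"
  proof clarify
    fix A B E assume A: "A \<in> faces K (i + 1)" "B \<in> faces K (i + 1)" and E: "E \<in> faces K i" "E \<subseteq> A" "E \<subseteq> B"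
    show "(A, B) \<in> {(A, B). face_adj K i A B}\<^sup>*"
    proof (cases "A = B")
      case False
      have fin: "finite A" "finite B" using A by (auto intro: face_finite)
      have "A \<inter> B \<subset> A"
      proof -
        have "A \<noteq> A \<inter> B"
          using False A card_subset_eq[OF fin(2), of A] by (auto simp: faces_def)
        then show ?thesis by blast
      qed
      then have "card (A \<inter> B) < card A" using fin by (intro psubset_card_mono)
      then have "E = A \<inter> B"
        using A E fin by (intro card_seteq) (auto simp: faces_def)
      then show ?thesis using A E False by (auto simp: face_adj_def)
    qed simp
  qed
  then have "?R\<^sup>* \<subseteq> {(A, B). face_adj K i A B}\<^sup>*" by (rule rtrancl_subset_rtrancl)
  moreover have "(F, G) \<in> ?R\<^sup>*"
    using assms(1-3) unfolding path_connected_Suc_def by blast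
  ultimately show ?thesis by blast
qed

theorem theorem7p2:
  fixes K :: "'a set set" and i :: nat
  assumes "abstract_complex K"
    and "path_connected_Suc K i"
    and "faces K (i + 1) \<noteq> {}"
  shows "real (i + 2) \<in> normalized_up_spectrum K i \<longleftrightarrow>
    \<not> (\<exists>L m. circuit_Suc K i m L \<and> orientable_Suc L i \<and> odd m) \<and>
    \<not> (\<exists>L m. circuit_Suc K i m L \<and> \<not> orientable_Suc L i \<and> even m)"
proof -
  interpret signed_graph "face_adj K i" face_sign by (rule signed_graph_faces)
  \<comment> \<open>Orientability is the switching condition for \<open>e = -1\<close>, so it holds
    exactly if the cycle has sign \<open>(-1) ^ m\<close>. Matching the parity of \<open>m\<close>
    is then the same as being positive.\<close>
  have orientable: "(orientable_Suc L i \<longleftrightarrow> even m) \<longleftrightarrow> cycle_sign c = 1"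
    if L: "circuit_Suc K i m L" and c: "induced_cycle c" "set c = faces L (i + 1)" "length c = m" for L m c
  proof -
    have "L \<subseteq> K" "abstract_complex L" using L by (auto simp: circuit_Suc_def pure_complex_def)
    then have "orientable_Suc L i \<longleftrightarrow> cycle_sign c = (-1) ^ m"
      using switching_induced_cycle_iff[OF c(1), of "-1"] c(2,3)
      by (simp add: orientable_Suc_iff coherently_orientable_iff_switching)
    moreover have "cycle_sign c = 1 \<or> cycle_sign c = -1"
      using cycle_sign_square[OF induced_cycle_closed_walk[OF c(1)]] by (simp add: zmult_eq_1_iff)
    ultimately show ?thesis by (cases "even m") auto
  qed
  have "real (i + 2) \<in> normalized_up_spectrum K i \<longleftrightarrow> coherently_orientable 1 K i"
    using coherent_of_eigenvalue[OF assms(1,2)] eigenvalue_of_coherent[OF assms(1,3)] by blast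
  also have "\<dots> \<longleftrightarrow> (\<exists>t. switching 1 (faces K (i + 1)) t)"
    using assms(1) by (intro coherently_orientable_iff_switching) auto
  also have "\<dots> \<longleftrightarrow> (\<forall>c. induced_cycle c \<longrightarrow> cycle_sign c = 1)"
  proof (intro iffI allI impI)
    fix c assume "\<exists>t. switching 1 (faces K (i + 1)) t" and c: "induced_cycle c"
    moreover have "set c \<subseteq> faces K (i + 1)"
    proof -
      obtain L where "circuit_Suc K i (length c) L" "faces L (i + 1) = set c"
        using induced_cycle_circuit_Suc[OF assms(1) c] .
      then show ?thesis by (auto simp: circuit_Suc_def faces_def)
    qed
    ultimately show "cycle_sign c = 1"
      using cycle_sign_switching[OF _ induced_cycle_closed_walk[OF c]] by fastforce
  next
    assume "\<forall>c. induced_cycle c \<longrightarrow> cycle_sign c = 1"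
    then have "\<And>c. closed_walk c \<Longrightarrow> cycle_sign c = 1" using closed_walk_positive by blast
    moreover obtain R where "R \<in> faces K (i + 1)" using assms(3) by blast
    ultimately show "\<exists>t. switching 1 (faces K (i + 1)) t"
      using path_connected_face_adj[OF assms(2) _ _ assms(1)] by (intro ex_switching) auto
  qed
  \<comment> \<open>The two exclusions in the statement together say that a circuit is orientable
    exactly if its length is even.\<close>
  also have "\<dots> \<longleftrightarrow> (\<forall>L m. circuit_Suc K i m L \<longrightarrow> (orientable_Suc L i \<longleftrightarrow> even m))"
  proof (rule iffI; intro allI impI)
    fix L m assume pos: "\<forall>c. induced_cycle c \<longrightarrow> cycle_sign c = 1" and L: "circuit_Suc K i m L"
    obtain c where c: "induced_cycle c" "set c = faces L (i + 1)" "length c = m"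
      using circuit_Suc_induced_cycle[OF L] .
    show "orientable_Suc L i \<longleftrightarrow> even m" using orientable[OF L c] pos c(1) by blast
  next
    fix c assume all: "\<forall>L m. circuit_Suc K i m L \<longrightarrow> (orientable_Suc L i \<longleftrightarrow> even m)" and c: "induced_cycle c"
    obtain L where L: "circuit_Suc K i (length c) L" "faces L (i + 1) = set c"
      using induced_cycle_circuit_Suc[OF assms(1) c] .
    show "cycle_sign c = 1" using orientable[OF L(1) c L(2)[symmetric] refl] all L(1) by blast
  qed
  finally show ?thesis by blast
qed

end
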